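(* Let $d\in\mathbb{Z}$ and $g_{1,d}(x)=x^4+x^3+d$, with $\tau$ a root. Suppose $g_{1,d}$ satisfies the hypotheses of the monogeneity theorem for $x^4+cx^3+d$ (with $c=1$): $d$ is square-free, $256d-27c^4$ is not divisible by the square of an odd prime, if $4\mid(256d-27c^4)$ then $(c,d)\equiv(0,1)$ or $(2,3)$ in $\mathbb{Z}/4\mathbb{Z}\times\mathbb{Z}/4\mathbb{Z}$, and $g_{c,d}$ is irreducible. If $d\neq -2$, then $\mathbb{Q}(\tau)$ has Galois group $S_4$. Moreover, the natural density of $d\in\mathbb{Z}$ for which $g_{1,d}$ satisfies these hypotheses, among all polynomials $x^4+x^3+d$ with $d\in\mathbb{Z}$, is at least $\frac{14-\pi^2}{\pi^2}\approx 41.85\%$.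
   Context: Under these hypotheses, $\mathbb{Q}(\tau)$ is monogenic and $\tau$ generates the ring of integers. *)

theory Defs
  imports
    Complex_Main
    "HOL-Computational_Algebra.Computational_Algebra"
    "HOL-Number_Theory.Cong"
    "HOL-Algebra.Bij"
    "HOL-Algebra.Sym_Groups"
    "HOL-Algebra.Generated_Fields"
    "HOL-Algebra.Algebraic_Closure_Type"
begin

definition g_poly :: "int \<Rightarrow> int \<Rightarrow> int poly" where
  "g_poly c d = monom 1 4 + monom c 3 + monom d 0"

definition monogeneity_hyps :: "int \<Rightarrow> int \<Rightarrow> bool" where
  "monogeneity_hyps c d \<longleftrightarrow>
     squarefree d \<and>
     (\<forall>p::int. Factorial_Ring.prime p \<and> odd p \<longrightarrow> \<not> p ^ 2 dvd 256 * d - 27 * c ^ 4) \<and>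
     (4 dvd 256 * d - 27 * c ^ 4 \<longrightarrow>
        ([c = 0] (mod 4) \<and> [d = 1] (mod 4)) \<or> ([c = 2] (mod 4) \<and> [d = 3] (mod 4))) \<and>
     Factorial_Ring.irreducible (map_poly of_int (g_poly c d) :: rat poly)"

abbreviation complex_field :: "complex ring" where
  "complex_field \<equiv> ring_of_type_algebra"

text \<open>Number fields are subfields of the complex numbers. The field generated by a set
  automatically contains the rationals.\<close>

definition rat_adjoin :: "complex \<Rightarrow> complex set" where
  "rat_adjoin x = generate_field complex_field {x}"

text \<open>In characteristic zero, a Galois extension is the same as an algebraic normal one. An
  irreducible polynomial splits in a subfield iff all of its complex roots lie there.\<close>

definition galois_over_rat :: "complex set \<Rightarrow> bool" where
  "galois_over_rat L \<longleftrightarrow>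
     subfield L complex_field \<and>
     (\<forall>x\<in>L. Polynomial.algebraic x) \<and>
     (\<forall>p::rat poly. Factorial_Ring.irreducible p \<and> (\<exists>x\<in>L. poly (map_poly of_rat p) x = 0) \<longrightarrow>
        (\<forall>z. poly (map_poly of_rat p) z = 0 \<longrightarrow> z \<in> L))"

definition galois_closure :: "complex set \<Rightarrow> complex set" where
  "galois_closure K = \<Inter>{L. galois_over_rat L \<and> K \<subseteq> L}"

text \<open>Automorphisms are extensional functions on the field, as in \<^const>\<open>BijGroup\<close>; the group
  law is composition.\<close>

definition galois_group :: "complex set \<Rightarrow> (complex \<Rightarrow> complex) monoid" where
  "galois_group L = (BijGroup L)
     \<lparr>carrier := {\<sigma> \<in> Bij L.
        \<sigma> \<in> ring_hom (complex_field\<lparr>carrier := L\<rparr>) (complex_field\<lparr>carrier := L\<rparr>) \<and>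
        (\<forall>q\<in>\<rat>. \<sigma> q = q)}\<rparr>"

text \<open>For a number field that need not be Galois, its Galois group is by convention the one of its
  Galois closure over the rationals.\<close>

definition has_galois_group :: "complex set \<Rightarrow> 'a monoid \<Rightarrow> bool" where
  "has_galois_group K G \<longleftrightarrow> galois_group (galois_closure K) \<cong> G"

definition has_natural_density :: "int set \<Rightarrow> real \<Rightarrow> bool" where
  "has_natural_density A \<delta> \<longleftrightarrow>
     (\<lambda>N::nat. real (card {d \<in> A. \<bar>d\<bar> \<le> int N}) / real (card {d::int. \<bar>d\<bar> \<le> int N}))
       \<longlonglongrightarrow> \<delta>"

end

(*
  Write K for the splitting field of g = x^4 + x^3 + d. An automorphism of K permutes the four roots
  x1, ..., x4 of g, so the Galois group is a subgroup H of S_4. It is transitive because g is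
  irreducible. The pairing x1 x2 + x3 x4 and its two conjugates are the roots of the resolvent cubic
  y^3 - 4 d y - d: a rational root y would be an integer, and since 4 y + 1 is prime to y and divides
  y^3, it would force y = 0 and d = 0. So H also permutes the three pairings transitively; this yields
  a 3-cycle, by transitivity 3-cycles around each of the four points, and hence A_4. Finally the
  discriminant d^2 (256 d - 27) is not a square, as 256 d - 27 = 5 mod 8, so H contains an odd
  permutation.

  For c = 1 irreducibility is automatic once d is square-free and d is not -2 (a factorisation into
  quadratics gives a rational root of the resolvent cubic), and 256 d - 27 is odd, so the hypotheses
  say that d and 256 d - 27 are both square-free. Sieving by the squares of the primes up to z leaves
  a periodic set. Its density is at least the sum of the densities of the two individual conditions
  minus 1, and the Euler product bounds these from below by 6/pi^2 and (6/pi^2)/(1 - 1/4) = 8/pi^2.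
  The tail p > z contributes O(1/z) + O(N^(-1/2)), so the densities of the sieved sets converge to
  the one wanted.
*)
theory Submission
  imports
    Defs
    "HOL-Analysis.Gamma_Function"
    "HOL-Real_Asymp.Real_Asymp"
begin

section \<open>Subfields of the complex numbers\<close>

text \<open>All automorphisms come from one principle, \<open>conjugation_extends\<close>: if an
  irreducible rational polynomial has a root in the splitting field, some embedding of that field
  sends this root to any other prescribed root. For g it gives transitivity on the roots, for the
  resolvent cubic transitivity on the pairings, and for y^2 - D^2, with D the product of the
  differences of the pairings, an automorphism with D -> -D, hence an odd permutation. One D serves
  both g and its resolvent, since a difference of two pairings is a product of two differences of
  roots. Thus no field degree and no group order is computed.

  The exact density is never computed either. Periodicity makes the density of each sieved set
  exist, the lower bound comes from treating the two conditions separately, and the final density is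
  a limit obtained from completeness. The term O(N^(-1/2)) is a bounded rounding error for each
  modulus k^2 with k up to sqrt(283 N), where 283 = 256 + 27 bounds |256 d - 27| by 283 N.\<close>

abbreviation csubfield :: "complex set \<Rightarrow> bool" where
  "csubfield K \<equiv> subfield K complex_field"

lemma complex_field_sel [simp]:
  "carrier complex_field = UNIV" "mult complex_field = (*)" "one complex_field = 1"
  "zero complex_field = 0" "add complex_field = (+)"
  by (simp_all add: ring_of_type_algebra_def)

lemma field_complex_field: "Ring.field complex_field"
  by (rule field_from_type_algebra)

lemma complex_field_a_inv [simp]: "a_inv complex_field x = - x"
proof -
  interpret C: Ring.field complex_field by (rule field_complex_field)
  show ?thesis using C.minus_equality[of "-x" x] by simp
qed

lemma complex_field_m_inv:
  assumes "x \<noteq> 0" shows "m_inv complex_field x = inverse x"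
proof -
  interpret C: Ring.field complex_field by (rule field_complex_field)
  show ?thesis using C.comm_inv_char[of x "inverse x"] assms by simp
qed

text \<open>As \<open>inverse 0 = 0\<close> in HOL, closure under \<open>inverse\<close> can be
  asked of every element, although \<open>m_inv\<close> agrees with \<open>inverse\<close> only away
  from 0.\<close>

lemma csubfield_iff:
  "csubfield K \<longleftrightarrow> 1 \<in> K \<and> (\<forall>x\<in>K. \<forall>y\<in>K. x + y \<in> K \<and> x * y \<in> K) \<and> (\<forall>x\<in>K. - x \<in> K \<and> inverse x \<in> K)"
    (is "_ \<longleftrightarrow> ?R")
proof
  interpret C: Ring.field complex_field by (rule field_complex_field)
  show ?R if K: "csubfield K"
  proof -
    have S: "subring K complex_field" by (rule subfieldE(1)[OF K])
    have "inverse x \<in> K" if "x \<in> K" for x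
    proof (cases "x = 0")
      case False
      then show ?thesis
        using C.subfield_m_inv(1)[OF K, of x] that by (simp add: complex_field_m_inv)
    qed (use that in simp)
    then show ?thesis
      using subringE[OF S] by simp
  qed
  show "csubfield K" if R: ?R
  proof (rule C.subfieldI')
    show "subring K complex_field"
      using R by (intro C.subringI) auto
  qed (use R in \<open>auto simp: complex_field_m_inv\<close>)
qed

lemma csubfieldD:
  assumes "csubfield K"
  shows csubfield_1: "1 \<in> K" and csubfield_0: "0 \<in> K"
    and csubfield_add: "\<And>x y. x \<in> K \<Longrightarrow> y \<in> K \<Longrightarrow> x + y \<in> K"
    and csubfield_mult: "\<And>x y. x \<in> K \<Longrightarrow> y \<in> K \<Longrightarrow> x * y \<in> K"
    and csubfield_minus: "\<And>x. x \<in> K \<Longrightarrow> - x \<in> K"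
    and csubfield_inverse: "\<And>x. x \<in> K \<Longrightarrow> inverse x \<in> K"
    and csubfield_diff: "\<And>x y. x \<in> K \<Longrightarrow> y \<in> K \<Longrightarrow> x - y \<in> K"
    and csubfield_divide: "\<And>x y. x \<in> K \<Longrightarrow> y \<in> K \<Longrightarrow> x / y \<in> K"
proof -
  note * = assms[unfolded csubfield_iff]
  show "1 \<in> K" using * by blast
  moreover show add: "\<And>x y. x \<in> K \<Longrightarrow> y \<in> K \<Longrightarrow> x + y \<in> K" using * by blast
  moreover show minus: "\<And>x. x \<in> K \<Longrightarrow> - x \<in> K" using * by blast
  ultimately show "0 \<in> K" by (metis add.right_inverse)
  show mult: "\<And>x y. x \<in> K \<Longrightarrow> y \<in> K \<Longrightarrow> x * y \<in> K" using * by blast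
  show inv: "\<And>x. x \<in> K \<Longrightarrow> inverse x \<in> K" using * by blast
  show "\<And>x y. x \<in> K \<Longrightarrow> y \<in> K \<Longrightarrow> x - y \<in> K" using add minus by (metis uminus_add_conv_diff add.commute)
  show "\<And>x y. x \<in> K \<Longrightarrow> y \<in> K \<Longrightarrow> x / y \<in> K" using mult inv by (metis divide_inverse)
qed

lemma csubfield_sum: "csubfield K \<Longrightarrow> (\<And>i. i \<in> A \<Longrightarrow> f i \<in> K) \<Longrightarrow> sum f A \<in> K"
  by (induction A rule: infinite_finite_induct) (auto simp: csubfield_0 csubfield_add)

lemma csubfield_of_nat: "csubfield K \<Longrightarrow> of_nat n \<in> K"
  by (induction n) (auto simp: csubfield_0 csubfield_1 csubfield_add)

lemma csubfield_of_int: "csubfield K \<Longrightarrow> of_int n \<in> K"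
  by (cases n rule: int_cases2) (auto simp: csubfield_of_nat csubfield_minus)

lemma csubfield_Rats: "csubfield K \<Longrightarrow> \<rat> \<subseteq> K"
  by (auto elim!: Rats_cases' simp: csubfield_of_int csubfield_divide)

lemma csubfield_RatsI: "csubfield \<rat>"
  by (simp add: csubfield_iff)

section \<open>Polynomials over a subfield, minimal polynomials and simple extensions\<close>

definition poly_over :: "complex set \<Rightarrow> complex poly \<Rightarrow> bool" where
  "poly_over K p \<longleftrightarrow> (\<forall>i. poly.coeff p i \<in> K)"

lemma poly_over_coeff: "poly_over K p \<Longrightarrow> poly.coeff p i \<in> K"
  by (simp add: poly_over_def)

lemma poly_over_mono: "poly_over K p \<Longrightarrow> K \<subseteq> L \<Longrightarrow> poly_over L p"
  by (auto simp: poly_over_def)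

lemma poly_over_Rats: "csubfield K \<Longrightarrow> poly_over \<rat> p \<Longrightarrow> poly_over K p"
  by (rule poly_over_mono[OF _ csubfield_Rats])

lemma poly_over_of_rat: "poly_over \<rat> (map_poly of_rat p)"
  by (simp add: poly_over_def coeff_map_poly)

lemma poly_over_0: "csubfield K \<Longrightarrow> poly_over K 0"
  by (simp add: poly_over_def csubfield_0)

lemma poly_over_pCons: "poly_over K p \<Longrightarrow> a \<in> K \<Longrightarrow> poly_over K (pCons a p)"
  by (auto simp: poly_over_def coeff_pCons split: nat.splits)

lemma poly_over_const: "csubfield K \<Longrightarrow> a \<in> K \<Longrightarrow> poly_over K [:a:]"
  by (intro poly_over_pCons poly_over_0)

lemma poly_over_add: "csubfield K \<Longrightarrow> poly_over K p \<Longrightarrow> poly_over K q \<Longrightarrow> poly_over K (p + q)"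
  by (simp add: poly_over_def csubfield_add)

lemma poly_over_minus: "csubfield K \<Longrightarrow> poly_over K p \<Longrightarrow> poly_over K (- p)"
  by (simp add: poly_over_def csubfield_minus)

lemma poly_over_diff: "csubfield K \<Longrightarrow> poly_over K p \<Longrightarrow> poly_over K q \<Longrightarrow> poly_over K (p - q)"
  by (simp add: poly_over_def csubfield_diff)

lemma poly_over_mult: "csubfield K \<Longrightarrow> poly_over K p \<Longrightarrow> poly_over K q \<Longrightarrow> poly_over K (p * q)"
  by (auto simp: poly_over_def coeff_mult intro!: csubfield_sum csubfield_mult)

lemma poly_over_monom: "csubfield K \<Longrightarrow> a \<in> K \<Longrightarrow> poly_over K (Polynomial.monom a n)"
  by (auto simp: poly_over_def csubfield_0)

lemma poly_over_pCons_iff: "poly_over K (pCons a p) \<longleftrightarrow> a \<in> K \<and> poly_over K p"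
proof
  assume *: "poly_over K (pCons a p)"
  show "a \<in> K \<and> poly_over K p"
    using poly_over_coeff[OF *, of 0] poly_over_coeff[OF *, of "Suc i" for i]
    by (simp add: poly_over_def)
qed (simp add: poly_over_pCons)

lemma poly_over_poly: "csubfield K \<Longrightarrow> poly_over K p \<Longrightarrow> x \<in> K \<Longrightarrow> poly p x \<in> K"
  by (induction p) (auto simp: poly_over_pCons_iff csubfield_0 csubfield_add csubfield_mult)

text \<open>Long division, repeated so as to control the coefficients: each step subtracts a
  monomial multiple of \<open>m\<close> whose coefficient is a quotient of leading coefficients and
  so stays in \<open>K\<close>.\<close>

lemma poly_over_division:
  assumes K: "csubfield K" and m: "poly_over K m" "m \<noteq> 0" and f: "poly_over K f"
  obtains q r where "poly_over K q" "poly_over K r" "f = q * m + r"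
    "r = 0 \<or> Polynomial.degree r < Polynomial.degree m"
proof -
  have "\<exists>q r. poly_over K q \<and> poly_over K r \<and> f = q * m + r \<and>
          (r = 0 \<or> Polynomial.degree r < Polynomial.degree m)"
    using f
  proof (induction "Polynomial.degree f" arbitrary: f rule: less_induct)
    case less
    show ?case
    proof (cases "f = 0 \<or> Polynomial.degree f < Polynomial.degree m")
      case True
      then show ?thesis
        using less.prems poly_over_0[OF K] by (intro exI[of _ 0] exI[of _ f]) auto
    next
      case False
      define t where "t = Polynomial.monom (lead_coeff f / lead_coeff m)
                            (Polynomial.degree f - Polynomial.degree m)"
      have t: "poly_over K t"
        unfolding t_def by (intro poly_over_monom csubfield_divide K) (use less.prems m in \<open>auto simp: poly_over_def\<close>)
      define g where "g = f - t * m"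
      have g: "poly_over K g"
        unfolding g_def by (intro poly_over_diff poly_over_mult K t m less.prems)
      have lc: "lead_coeff f / lead_coeff m \<noteq> 0" using False m by simp
      have dt: "Polynomial.degree t = Polynomial.degree f - Polynomial.degree m"
        using lc by (simp add: t_def degree_monom_eq)
      have lt: "lead_coeff t = lead_coeff f / lead_coeff m"
        unfolding t_def lead_coeff_monom ..
      then have tnz: "t \<noteq> 0" using lc by (metis leading_coeff_0_iff)
      have tm: "Polynomial.degree (t * m) = Polynomial.degree f"
        using dt False m(2) tnz by (simp add: degree_mult_eq)
      have tm': "lead_coeff (t * m) = lead_coeff f"
        unfolding lead_coeff_mult lt using m(2) by simp
      show ?thesis
      proof (cases "g = 0")
        case True
        then show ?thesis
          using t poly_over_0[OF K] by (intro exI[of _ t] exI[of _ 0]) (auto simp: g_def)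
      next
        case gnz: False
        have "Polynomial.degree g \<le> Polynomial.degree f"
          unfolding g_def using tm by (intro degree_diff_le) auto
        moreover have "poly.coeff g (Polynomial.degree f) = 0"
          using tm tm' by (simp add: g_def)
        ultimately have "Polynomial.degree g < Polynomial.degree f"
          using gnz by (metis le_neq_implies_less leading_coeff_0_iff)
        from less.hyps[OF this g] obtain q r where qr: "poly_over K q" "poly_over K r" "g = q * m + r"
            "r = 0 \<or> Polynomial.degree r < Polynomial.degree m" by blast
        then have "f = (q + t) * m + r" by (simp add: g_def algebra_simps)
        with qr t poly_over_add[OF K qr(1) t] show ?thesis by blast
      qed
    qed
  qed
  with that show ?thesis by blast
qed

text \<open>Minimality of the degree is the working property, as it forces remainders to vanish. The
  polynomial is not normalised, so it is determined only up to a scalar.\<close>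

definition minimal_poly_over :: "complex set \<Rightarrow> complex \<Rightarrow> complex poly \<Rightarrow> bool" where
  "minimal_poly_over K \<alpha> m \<longleftrightarrow> poly_over K m \<and> m \<noteq> 0 \<and> poly m \<alpha> = 0 \<and>
     (\<forall>q. poly_over K q \<and> q \<noteq> 0 \<and> poly q \<alpha> = 0 \<longrightarrow> Polynomial.degree m \<le> Polynomial.degree q)"

lemma minimal_poly_over_exists:
  assumes "poly_over K p" "p \<noteq> 0" "poly p \<alpha> = 0"
  obtains m where "minimal_poly_over K \<alpha> m"
proof -
  let ?P = "\<lambda>q. poly_over K q \<and> q \<noteq> 0 \<and> poly q \<alpha> = 0"
  have "?P p" using assms by simp
  from that[unfolded minimal_poly_over_def, of "arg_min Polynomial.degree ?P"]
    arg_min_nat_lemma[of ?P, OF this, of Polynomial.degree]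
  show ?thesis by blast
qed

lemma minimal_poly_over_dvd:
  assumes "csubfield K" "minimal_poly_over K \<alpha> m" "poly_over K p" "poly p \<alpha> = 0"
  obtains q where "poly_over K q" "p = q * m"
proof -
  note m = assms(2)[unfolded minimal_poly_over_def]
  obtain q r where qr: "poly_over K q" "poly_over K r" "p = q * m + r"
      "r = 0 \<or> Polynomial.degree r < Polynomial.degree m"
    using poly_over_division[OF assms(1) _ _ assms(3), of m] m by blast
  have "poly r \<alpha> = 0" using qr(3) m assms(4) by simp
  with m qr(2,4) have "r = 0" by force
  with qr that show ?thesis by simp
qed

lemma minimal_poly_over_degree_pos:
  assumes "minimal_poly_over K \<alpha> m" shows "Polynomial.degree m > 0"
proof (rule ccontr)
  assume "\<not> ?thesis"
  then obtain c where "m = [:c:]" by (auto elim: degree_eq_zeroE)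
  with assms show False by (auto simp: minimal_poly_over_def)
qed

text \<open>The ring K[\<alpha>], without fractions; \<open>csubfield_adjoin\<close> shows that it
  is a field as soon as \<alpha> has a minimal polynomial.\<close>

definition adjoin :: "complex set \<Rightarrow> complex \<Rightarrow> complex set" where
  "adjoin K \<alpha> = {poly p \<alpha> | p. poly_over K p}"

lemma adjoin_generator: "csubfield K \<Longrightarrow> \<alpha> \<in> adjoin K \<alpha>"
  unfolding adjoin_def
  by (intro CollectI exI[of _ "[:0, 1:]"]) (auto intro!: poly_over_pCons poly_over_0 csubfield_0 csubfield_1)

lemma adjoin_superset: "csubfield K \<Longrightarrow> K \<subseteq> adjoin K \<alpha>"
  unfolding adjoin_def using poly_over_const by force

lemma adjoin_reduce:
  assumes "csubfield K" "minimal_poly_over K \<alpha> m" "y \<in> adjoin K \<alpha>"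
  obtains p where "poly_over K p" "y = poly p \<alpha>" "p = 0 \<or> Polynomial.degree p < Polynomial.degree m"
proof -
  note m = assms(2)[unfolded minimal_poly_over_def]
  from assms(3) obtain f where f: "poly_over K f" "y = poly f \<alpha>" by (auto simp: adjoin_def)
  obtain q r where "poly_over K q" "poly_over K r" "f = q * m + r"
      "r = 0 \<or> Polynomial.degree r < Polynomial.degree m"
    using poly_over_division[OF assms(1) _ _ f(1), of m] m by blast
  with m f that[of r] show ?thesis by simp
qed

text \<open>Euclid's algorithm as a descent on the degree of \<open>p\<close>. Write
  \<open>m = s * p + r\<close>. Here \<open>r\<close> is not 0, else \<open>s\<close> would vanish
  at \<alpha> in too low a degree. As \<open>s * p\<close> and \<open>- r\<close> agree at \<alpha>,
  an inverse \<open>q\<close> of \<open>r\<close> there yields the inverse \<open>- (s * q)\<close>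
  of \<open>p\<close>.\<close>

lemma adjoin_inverse_aux:
  assumes K: "csubfield K" and min: "minimal_poly_over K \<alpha> m"
  shows "poly_over K p \<Longrightarrow> p \<noteq> 0 \<Longrightarrow> Polynomial.degree p < Polynomial.degree m \<Longrightarrow>
    \<exists>q. poly_over K q \<and> poly p \<alpha> * poly q \<alpha> = 1"
proof (induction "Polynomial.degree p" arbitrary: p rule: less_induct)
  case less
  note m = min[unfolded minimal_poly_over_def]
  show ?case
  proof (cases "Polynomial.degree p = 0")
    case True
    then obtain c where c: "p = [:c:]" by (auto elim: degree_eq_zeroE)
    then have "c \<in> K" using less.prems(1) poly_over_coeff[of K p 0] by simp
    then show ?thesis
      using c less.prems K
      by (intro exI[of _ "[:inverse c:]"]) (auto intro!: poly_over_const csubfield_inverse)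
  next
    case False
    obtain s r where sr: "poly_over K s" "poly_over K r" "m = s * p + r"
      "r = 0 \<or> Polynomial.degree r < Polynomial.degree p"
      using poly_over_division[OF K less.prems(1,2), of m] m by blast
    have pnz: "poly p \<alpha> \<noteq> 0"
      using m less.prems by force
    have e: "poly s \<alpha> * poly p \<alpha> + poly r \<alpha> = 0" using m sr(3) by (metis poly_add poly_mult)
    have "r \<noteq> 0"
    proof
      assume r: "r = 0"
      then have "poly s \<alpha> = 0" using e pnz by simp
      moreover have "s \<noteq> 0" using r sr(3) m by auto
      ultimately have "Polynomial.degree m \<le> Polynomial.degree s" using m sr(1) by blast
      then show False using sr(3) r \<open>s \<noteq> 0\<close> less.prems(2) False by (simp add: degree_mult_eq)
    qed
    then obtain q where q: "poly_over K q" "poly r \<alpha> * poly q \<alpha> = 1"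
      using less.hyps[of r] sr less.prems(3) by auto
    have "poly p \<alpha> * poly (- (s * q)) \<alpha> = (poly s \<alpha> * poly p \<alpha> + poly r \<alpha>) * (- poly q \<alpha>) + poly r \<alpha> * poly q \<alpha>"
      by (simp add: algebra_simps)
    also have "\<dots> = 1" unfolding e q(2) by simp
    finally show ?thesis using poly_over_minus[OF K poly_over_mult[OF K sr(1) q(1)]] by blast
  qed
qed

lemma csubfield_adjoin:
  assumes K: "csubfield K" and min: "minimal_poly_over K \<alpha> m"
  shows "csubfield (adjoin K \<alpha>)"
  unfolding csubfield_iff
proof (intro conjI ballI)
  show "1 \<in> adjoin K \<alpha>" using adjoin_superset[OF K] csubfield_1[OF K] by blast
next
  fix x y assume "x \<in> adjoin K \<alpha>" "y \<in> adjoin K \<alpha>"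
  then obtain p q where pq: "poly_over K p" "x = poly p \<alpha>" "poly_over K q" "y = poly q \<alpha>"
    by (auto simp: adjoin_def)
  show "x + y \<in> adjoin K \<alpha>" unfolding adjoin_def
    using poly_over_add[OF K pq(1,3)] pq(2,4) by (intro CollectI exI[of _ "p + q"]) auto
  show "x * y \<in> adjoin K \<alpha>" unfolding adjoin_def
    using poly_over_mult[OF K pq(1,3)] pq(2,4) by (intro CollectI exI[of _ "p * q"]) auto
next
  fix x assume x: "x \<in> adjoin K \<alpha>"
  then obtain p where p: "poly_over K p" "x = poly p \<alpha>" by (auto simp: adjoin_def)
  show "- x \<in> adjoin K \<alpha>" unfolding adjoin_def
    using poly_over_minus[OF K p(1)] p(2) by (intro CollectI exI[of _ "- p"]) auto
  obtain p where p: "poly_over K p" "x = poly p \<alpha>" "p = 0 \<or> Polynomial.degree p < Polynomial.degree m"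
    by (rule adjoin_reduce[OF K min x])
  show "inverse x \<in> adjoin K \<alpha>"
  proof (cases "p = 0")
    case False
    then obtain q where "poly_over K q" "poly p \<alpha> * poly q \<alpha> = 1"
      using adjoin_inverse_aux[OF K min p(1)] p(3) by blast
    then show ?thesis unfolding adjoin_def p(2) by (intro CollectI exI[of _ q]) (auto intro: inverse_unique)
  next
    case True
    then show ?thesis using p(2) csubfield_0[OF K] adjoin_superset[OF K] by auto
  qed
qed

section \<open>Extension of embeddings\<close>

text \<open>A total function of which only the values on \<open>K\<close> are constrained, so
  passing to a subfield needs no restriction. Requiring \<phi> 1 = 1 excludes the zero map.\<close>

definition field_emb :: "complex set \<Rightarrow> (complex \<Rightarrow> complex) \<Rightarrow> bool" where
  "field_emb K \<phi> \<longleftrightarrow> \<phi> 1 = 1 \<and> (\<forall>x\<in>K. \<forall>y\<in>K. \<phi> (x + y) = \<phi> x + \<phi> y \<and> \<phi> (x * y) = \<phi> x * \<phi> y)"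

lemma field_emb_subset: "field_emb L \<phi> \<Longrightarrow> K \<subseteq> L \<Longrightarrow> field_emb K \<phi>"
  by (auto simp: field_emb_def)

lemma field_emb_id: "field_emb K (\<lambda>x. x)"
  by (auto simp: field_emb_def)

context
  fixes K \<phi>
  assumes K: "csubfield K" and emb: "field_emb K \<phi>"
begin

lemma emb_1: "\<phi> 1 = 1" and emb_add: "x \<in> K \<Longrightarrow> y \<in> K \<Longrightarrow> \<phi> (x + y) = \<phi> x + \<phi> y"
  and emb_mult: "x \<in> K \<Longrightarrow> y \<in> K \<Longrightarrow> \<phi> (x * y) = \<phi> x * \<phi> y"
  using emb by (auto simp: field_emb_def)

lemma emb_0: "\<phi> 0 = 0"
  using emb_add[of 0 0] csubfield_0[OF K] by simp

lemma emb_minus: "x \<in> K \<Longrightarrow> \<phi> (- x) = - \<phi> x"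
  using emb_add[of x "- x"] csubfield_minus[OF K, of x] emb_0 by (simp add: eq_neg_iff_add_eq_0 add.commute)

lemma emb_diff: "x \<in> K \<Longrightarrow> y \<in> K \<Longrightarrow> \<phi> (x - y) = \<phi> x - \<phi> y"
  using emb_add[of x "- y"] csubfield_minus[OF K, of y] emb_minus[of y] by simp

lemma emb_eq_0_iff: "x \<in> K \<Longrightarrow> \<phi> x = 0 \<longleftrightarrow> x = 0"
  using emb_mult[of x "inverse x"] csubfield_inverse[OF K, of x] emb_1 emb_0 by (cases "x = 0") auto

lemma emb_inj_on: "inj_on \<phi> K"
proof (rule inj_onI)
  fix x y assume xy: "x \<in> K" "y \<in> K" "\<phi> x = \<phi> y"
  then have "\<phi> (x - y) = 0" by (simp add: emb_diff)
  then show "x = y" using emb_eq_0_iff[OF csubfield_diff[OF K xy(1,2)]] by simp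
qed

lemma emb_inverse: "x \<in> K \<Longrightarrow> \<phi> (inverse x) = inverse (\<phi> x)"
  using emb_mult[of x "inverse x"] csubfield_inverse[OF K, of x] emb_1 emb_0
  by (cases "x = 0") (auto intro: inverse_unique[symmetric])

lemma emb_sum: "(\<And>i. i \<in> A \<Longrightarrow> f i \<in> K) \<Longrightarrow> \<phi> (sum f A) = (\<Sum>i\<in>A. \<phi> (f i))"
  by (induction A rule: infinite_finite_induct) (auto simp: emb_0 emb_add csubfield_sum[OF K])

lemma emb_of_nat: "\<phi> (of_nat n) = of_nat n"
  by (induction n) (auto simp: emb_0 emb_1 emb_add csubfield_of_nat[OF K] csubfield_1[OF K])

lemma emb_of_int: "\<phi> (of_int n) = of_int n"
  by (cases n rule: int_cases2) (auto simp: emb_of_nat emb_minus csubfield_of_nat[OF K])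

lemma emb_Rats: "q \<in> \<rat> \<Longrightarrow> \<phi> q = q"
proof (elim Rats_cases')
  fix a b :: int assume "q = of_int a / of_int b"
  then have q: "q = of_int a * inverse (of_int b)" by (simp add: divide_inverse)
  have b: "of_int b \<in> K" by (rule csubfield_of_int[OF K])
  show ?thesis
    unfolding q emb_mult[OF csubfield_of_int[OF K] csubfield_inverse[OF K b]] emb_inverse[OF b]
      emb_of_int ..
qed

lemma emb_poly_add:
  assumes "poly_over K p" "poly_over K q"
  shows "map_poly \<phi> (p + q) = map_poly \<phi> p + map_poly \<phi> q"
  using assms by (intro poly_eqI) (auto simp: coeff_map_poly emb_0 emb_add poly_over_def)

lemma emb_poly_diff:
  assumes "poly_over K p" "poly_over K q"
  shows "map_poly \<phi> (p - q) = map_poly \<phi> p - map_poly \<phi> q"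
  using assms by (intro poly_eqI) (auto simp: coeff_map_poly emb_0 emb_diff poly_over_def)

lemma emb_poly_mult:
  assumes "poly_over K p" "poly_over K q"
  shows "map_poly \<phi> (p * q) = map_poly \<phi> p * map_poly \<phi> q"
  using assms
  by (intro poly_eqI)
     (auto simp: coeff_map_poly emb_0 emb_mult emb_sum coeff_mult poly_over_def csubfield_mult[OF K])

lemma emb_poly_eval:
  assumes "poly_over K p" "x \<in> K"
  shows "poly (map_poly \<phi> p) (\<phi> x) = \<phi> (poly p x)"
  using assms
proof (induction p)
  case (pCons a p)
  then have "a \<in> K" "poly_over K p" by (auto simp: poly_over_pCons_iff)
  with pCons show ?case
    by (simp add: map_poly_pCons emb_0 emb_add emb_mult csubfield_mult[OF K] poly_over_poly[OF K])
qed (simp add: emb_0)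

lemma emb_poly_degree:
  assumes "poly_over K p"
  shows "Polynomial.degree (map_poly \<phi> p) = Polynomial.degree p"
proof (cases "p = 0")
  case False
  then have "\<phi> (lead_coeff p) \<noteq> 0"
    using emb_eq_0_iff[OF poly_over_coeff[OF assms]] by auto
  then show ?thesis by (rule map_poly_degree_eq)
qed simp

lemma emb_poly_Rats: "poly_over \<rat> p \<Longrightarrow> map_poly \<phi> p = p"
  by (intro poly_eqI) (auto simp: coeff_map_poly emb_0 emb_Rats poly_over_def)

text \<open>The extension sends the value of \<open>p\<close> at \<alpha> to the value of the
  transported \<open>p\<close> at \<beta>. Two choices of \<open>p\<close> differ by a multiple of
  \<open>m\<close>, whose transport vanishes at \<beta>, so the arbitrary choice by
  \<open>SOME\<close> does no harm.\<close>

lemma emb_extend_simple: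
  assumes min: "minimal_poly_over K \<alpha> m" and \<beta>: "poly (map_poly \<phi> m) \<beta> = 0"
  obtains \<psi> where "field_emb (adjoin K \<alpha>) \<psi>" "\<And>x. x \<in> K \<Longrightarrow> \<psi> x = \<phi> x" "\<psi> \<alpha> = \<beta>"
proof -
  note m = min[unfolded minimal_poly_over_def]
  define \<psi> where "\<psi> y = poly (map_poly \<phi> (SOME p. poly_over K p \<and> y = poly p \<alpha>)) \<beta>" for y
  have wd: "poly (map_poly \<phi> p) \<beta> = poly (map_poly \<phi> q) \<beta>"
    if p: "poly_over K p" and q: "poly_over K q" and eq: "poly p \<alpha> = poly q \<alpha>" for p q
  proof -
    have "poly (p - q) \<alpha> = 0" using eq by simp
    then obtain r where r: "poly_over K r" "p - q = r * m"
      using minimal_poly_over_dvd[OF K min poly_over_diff[OF K p q]] by blast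
    have "map_poly \<phi> p - map_poly \<phi> q = map_poly \<phi> r * map_poly \<phi> m"
      using emb_poly_diff[OF p q] emb_poly_mult[OF r(1), of m] m r(2) by simp
    then have "poly (map_poly \<phi> p - map_poly \<phi> q) \<beta> = 0" using \<beta> by simp
    then show ?thesis by simp
  qed
  have \<psi>: "\<psi> (poly p \<alpha>) = poly (map_poly \<phi> p) \<beta>" if "poly_over K p" for p
  proof -
    let ?P = "\<lambda>q. poly_over K q \<and> poly p \<alpha> = poly q \<alpha>"
    have "?P (SOME q. ?P q)" using that by (intro someI[of ?P p]) simp
    then show ?thesis unfolding \<psi>_def using that by (intro wd) auto
  qed
  show ?thesis
  proof
    show "\<psi> x = \<phi> x" if "x \<in> K" for x
      using \<psi>[OF poly_over_const[OF K that]] by (simp add: map_poly_pCons emb_0)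
    then have 1: "\<psi> 1 = 1" using csubfield_1[OF K] emb_1 by simp
    show "\<psi> \<alpha> = \<beta>"
      using \<psi>[of "[:0, 1:]"] csubfield_0[OF K] csubfield_1[OF K] emb_0 emb_1
      by (simp add: poly_over_pCons_iff poly_over_0[OF K] map_poly_pCons)
    show "field_emb (adjoin K \<alpha>) \<psi>"
      unfolding field_emb_def
    proof (intro conjI ballI 1)
      fix x y assume "x \<in> adjoin K \<alpha>" "y \<in> adjoin K \<alpha>"
      then obtain p q where pq: "poly_over K p" "x = poly p \<alpha>" "poly_over K q" "y = poly q \<alpha>"
        by (auto simp: adjoin_def)
      show "\<psi> (x + y) = \<psi> x + \<psi> y"
        using \<psi>[OF poly_over_add[OF K pq(1,3)]] pq \<psi> emb_poly_add[OF pq(1,3)] by simp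
      show "\<psi> (x * y) = \<psi> x * \<psi> y"
        using \<psi>[OF poly_over_mult[OF K pq(1,3)]] pq \<psi> emb_poly_mult[OF pq(1,3)] by simp
    qed
  qed
qed

end

text \<open>One element is adjoined at a time. Its image can be any root of the transported minimal
  polynomial, and there is one because the target is the field of complex numbers.\<close>

lemma emb_extend_finite:
  assumes "finite S"
  shows "csubfield K \<Longrightarrow> field_emb K \<phi> \<Longrightarrow> \<forall>\<alpha>\<in>S. \<exists>p. poly_over K p \<and> p \<noteq> 0 \<and> poly p \<alpha> = 0 \<Longrightarrow>
    \<exists>L \<psi>. csubfield L \<and> field_emb L \<psi> \<and> K \<subseteq> L \<and> S \<subseteq> L \<and> (\<forall>x\<in>K. \<psi> x = \<phi> x)"
  using assms
proof (induction S arbitrary: K \<phi> rule: finite_induct)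
  case (insert \<alpha> S)
  note K = insert.prems(1) and emb = insert.prems(2)
  obtain m where min: "minimal_poly_over K \<alpha> m"
    using insert.prems(3) minimal_poly_over_exists by (metis insertI1)
  note m = min[unfolded minimal_poly_over_def]
  have "\<not> constant (poly (map_poly \<phi> m))"
    using minimal_poly_over_degree_pos[OF min] emb_poly_degree[OF K emb, of m] m
    by (simp add: constant_degree)
  then obtain \<beta> where \<beta>: "poly (map_poly \<phi> m) \<beta> = 0"
    using fundamental_theorem_of_algebra by blast
  obtain \<psi> where \<psi>: "field_emb (adjoin K \<alpha>) \<psi>" "\<And>x. x \<in> K \<Longrightarrow> \<psi> x = \<phi> x"
    using emb_extend_simple[OF K emb min \<beta>] by blast
  have K': "csubfield (adjoin K \<alpha>)" by (rule csubfield_adjoin[OF K min])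
  have sub: "K \<subseteq> adjoin K \<alpha>" by (rule adjoin_superset[OF K])
  have "\<forall>\<beta>\<in>S. \<exists>p. poly_over (adjoin K \<alpha>) p \<and> p \<noteq> 0 \<and> poly p \<beta> = 0"
    using insert.prems(3) poly_over_mono[OF _ sub] by (metis insertI2)
  from insert.IH[OF K' \<psi>(1) this] obtain L \<rho> where
    L: "csubfield L" "field_emb L \<rho>" "adjoin K \<alpha> \<subseteq> L" "S \<subseteq> L" "\<forall>x\<in>adjoin K \<alpha>. \<rho> x = \<psi> x"
    by blast
  have "\<alpha> \<in> adjoin K \<alpha>" by (rule adjoin_generator[OF K])
  with L sub \<psi>(2) show ?case
    by (intro exI[of _ L] exI[of _ \<rho>]) auto
qed auto

text \<open>Links irreducibility in \<open>rat poly\<close> with minimality of degree. In the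
  factorisation \<open>p = q * m\<close> over the rationals one factor is a unit; it cannot be
  \<open>m\<close>, which has a root, so \<open>q\<close> is constant and \<open>m\<close> inherits
  every root of \<open>p\<close>.\<close>

lemma irreducible_rat_minimal:
  fixes p :: "rat poly"
  assumes irr: "Factorial_Ring.irreducible p" and u: "poly (map_poly of_rat p) u = 0"
    and min: "minimal_poly_over \<rat> u m" and v: "poly (map_poly of_rat p) v = 0"
  shows "poly m v = 0"
proof -
  note m = min[unfolded minimal_poly_over_def]
  have rat: "\<exists>q' :: rat poly. q = map_poly of_rat q'" if "poly_over \<rat> q" for q
  proof (intro exI poly_eqI)
    fix i
    have "\<exists>r. poly.coeff q i = of_rat r" for i
      using poly_over_coeff[OF that, of i] by (auto elim: Rats_cases)
    then have "of_rat (inv_into UNIV of_rat (poly.coeff q i)) = poly.coeff q i" for i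
      by (metis f_inv_into_f rangeI)
    \<comment> \<open>\<open>coeff_map_poly\<close> applies only to functions that fix 0.\<close>
    moreover have "inv_into UNIV of_rat (0 :: complex) = (0 :: rat)"
      by (metis inv_f_f of_rat_0 injI of_rat_eq_iff)
    ultimately show "poly.coeff q i = poly.coeff (map_poly of_rat (map_poly (inv_into UNIV of_rat) q)) i"
      by (simp add: coeff_map_poly)
  qed
  have hom: "map_poly of_rat (a * b) = (map_poly of_rat a * map_poly of_rat b :: complex poly)" for a b
    by (intro poly_eqI) (simp add: coeff_map_poly coeff_mult of_rat_sum of_rat_mult)
  have inj: "map_poly of_rat a = (map_poly of_rat b :: complex poly) \<Longrightarrow> a = b" for a b
    by (metis (no_types, lifting) coeff_map_poly of_rat_0 of_rat_eq_iff poly_eqI)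
  obtain q where q: "poly_over \<rat> q" "map_poly of_rat p = q * m"
    using minimal_poly_over_dvd[OF csubfield_RatsI min poly_over_of_rat u] by blast
  obtain q' m' where q': "q = map_poly of_rat q'" "m = map_poly of_rat m'"
    using rat q(1) m by metis
  have "p = q' * m'" using q(2) unfolding q' by (intro inj) (simp add: hom)
  then consider "is_unit q'" | "is_unit m'" using Factorial_Ring.irreducibleD[OF irr] by blast
  then show ?thesis
  proof cases
    case 1
    then obtain c where c: "q' = [:c:]" "c \<noteq> 0"
      by (metis is_unit_polyE not_is_unit_0)
    then have "q = [:of_rat c:]" by (simp add: q' map_poly_pCons)
    then show ?thesis using v c unfolding q(2) by simp
  next
    case 2
    then obtain c where "m' = [:c:]" "c \<noteq> 0"
      by (metis is_unit_polyE not_is_unit_0)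
    then have "m = [:of_rat c:]" by (simp add: q' map_poly_pCons)
    then show ?thesis using m \<open>c \<noteq> 0\<close> by simp
  qed
qed

section \<open>Splitting fields and conjugation\<close>

lemma csubfield_generate: "csubfield (generate_field complex_field S)"
proof -
  interpret C: Ring.field complex_field by (rule field_complex_field)
  show ?thesis by (rule C.generate_field_is_subfield) simp
qed

lemma generate_superset: "S \<subseteq> generate_field complex_field S"
  by (auto intro: generate_field.incl)

lemma generate_least:
  assumes "csubfield E" "S \<subseteq> E"
  shows "generate_field complex_field S \<subseteq> E"
proof -
  interpret C: Ring.field complex_field by (rule field_complex_field)
  show ?thesis by (rule C.generate_field_min_subfield1) (use assms in simp_all)
qed

lemma csubfield_image_emb:
  assumes K: "csubfield K" and emb: "field_emb K \<phi>"
  shows "csubfield (\<phi> ` K)"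
  unfolding csubfield_iff
proof (intro conjI ballI)
  show "1 \<in> \<phi> ` K" using csubfield_1[OF K] emb_1[OF K emb] by force
next
  fix x y assume "x \<in> \<phi> ` K" "y \<in> \<phi> ` K"
  then obtain a b where ab: "a \<in> K" "x = \<phi> a" "b \<in> K" "y = \<phi> b" by auto
  show "x + y \<in> \<phi> ` K" "x * y \<in> \<phi> ` K"
    using ab emb_add[OF K emb, of a b] emb_mult[OF K emb, of a b] csubfield_add[OF K, of a b]
      csubfield_mult[OF K, of a b] by (metis imageI)+
next
  fix x assume "x \<in> \<phi> ` K"
  then obtain a where a: "a \<in> K" "x = \<phi> a" by auto
  show "- x \<in> \<phi> ` K" "inverse x \<in> \<phi> ` K"
    using a emb_minus[OF K emb, of a] emb_inverse[OF K emb, of a] csubfield_minus[OF K, of a]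
      csubfield_inverse[OF K, of a] by (metis imageI)+
qed

text \<open>This lemma and the next allow arguments on generators: the set where a property of an
  embedding holds is a subfield, so by \<open>generate_least\<close> it is everything once it
  contains the generators.\<close>

lemma csubfield_vimage_emb:
  assumes K: "csubfield K" and emb: "field_emb K \<phi>" and E: "csubfield E"
  shows "csubfield {x \<in> K. \<phi> x \<in> E}"
  unfolding csubfield_iff
  using csubfieldD[OF K] csubfieldD[OF E] emb_1[OF K emb] emb_add[OF K emb] emb_mult[OF K emb]
    emb_minus[OF K emb] emb_inverse[OF K emb]
  by auto

lemma csubfield_equalizer_emb:
  assumes K: "csubfield K" and \<phi>: "field_emb K \<phi>" and \<psi>: "field_emb K \<psi>"
  shows "csubfield {x \<in> K. \<phi> x = \<psi> x}"
  unfolding csubfield_iff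
  using csubfieldD[OF K] emb_1[OF K \<phi>] emb_add[OF K \<phi>] emb_mult[OF K \<phi>]
    emb_minus[OF K \<phi>] emb_inverse[OF K \<phi>] emb_1[OF K \<psi>] emb_add[OF K \<psi>] emb_mult[OF K \<psi>]
    emb_minus[OF K \<psi>] emb_inverse[OF K \<psi>]
  by auto

lemma emb_eqI_generate:
  assumes "field_emb (generate_field complex_field S) \<phi>" "field_emb (generate_field complex_field S) \<psi>"
    "\<And>s. s \<in> S \<Longrightarrow> \<phi> s = \<psi> s" "x \<in> generate_field complex_field S"
  shows "\<phi> x = \<psi> x"
proof -
  let ?L = "generate_field complex_field S"
  have "?L \<subseteq> {x \<in> ?L. \<phi> x = \<psi> x}"
    using generate_superset assms(3)
    by (intro generate_least csubfield_equalizer_emb csubfield_generate assms) auto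
  with assms(4) show ?thesis by auto
qed

text \<open>An embedding fixes the rational coefficients of \<open>G\<close>, so it maps the finite
  set \<open>S\<close> injectively into itself, hence onto. The image of \<open>L\<close> is then a
  subfield containing \<open>S\<close>, which gives surjectivity on \<open>L\<close> without
  counting dimensions.\<close>

lemma emb_generate_roots_surj:
  assumes G: "poly_over \<rat> G" "G \<noteq> 0" and S: "S = {z. poly G z = 0}"
    and L: "L = generate_field complex_field S" and emb: "field_emb L \<sigma>"
  shows "\<sigma> ` S = S" "\<sigma> ` L = L"
proof -
  have K: "csubfield L" unfolding L by (rule csubfield_generate)
  have SL: "S \<subseteq> L" unfolding L by (rule generate_superset)
  have "\<sigma> ` S \<subseteq> S"
  proof safe
    fix s assume s: "s \<in> S"
    have "poly (map_poly \<sigma> G) (\<sigma> s) = \<sigma> (poly G s)"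
      using SL s by (intro emb_poly_eval[OF K emb] poly_over_Rats[OF K G(1)]) auto
    then show "\<sigma> s \<in> S" using s S emb_poly_Rats[OF K emb G(1)] emb_0[OF K emb] by simp
  qed
  moreover have "finite S" unfolding S by (rule poly_roots_finite[OF G(2)])
  moreover have "inj_on \<sigma> S" using emb_inj_on[OF K emb] SL inj_on_subset by blast
  ultimately show im: "\<sigma> ` S = S" by (simp add: endo_inj_surj)
  have "L \<subseteq> {x \<in> L. \<sigma> x \<in> L}"
    using SL im unfolding L[symmetric]
    by (subst (1) L, intro generate_least csubfield_vimage_emb K emb) auto
  moreover have "L \<subseteq> \<sigma> ` L"
    by (subst (1) L, intro generate_least csubfield_image_emb K emb) (use im SL in blast)
  ultimately show "\<sigma> ` L = L" by auto
qed

lemma irreducible_map_poly_of_rat_nonzero: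
  assumes "Factorial_Ring.irreducible (p :: rat poly)"
  shows "map_poly of_rat p \<noteq> (0 :: complex poly)"
proof
  assume 0: "map_poly of_rat p = (0 :: complex poly)"
  have "poly.coeff p i = 0" for i
    using arg_cong[OF 0, of "\<lambda>q. poly.coeff q i"] by (simp add: coeff_map_poly)
  then have "p = 0" by (intro poly_eqI) simp
  with assms show False unfolding Factorial_Ring.irreducible_def by blast
qed

text \<open>The identity of the rationals extends to an embedding with u -> v, then to a field
  containing all roots of \<open>G\<close>. Membership of \<open>v\<close> in \<open>L\<close> is
  not assumed; it becomes a consequence, which is how normality is proved below.\<close>

lemma conjugation_extends:
  assumes G: "poly_over \<rat> G" "G \<noteq> 0" and S: "S = {z. poly G z = 0}"
    and L: "L = generate_field complex_field S"
    and p: "Factorial_Ring.irreducible p" "poly (map_poly of_rat p) u = 0" "poly (map_poly of_rat p) v = 0"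
    and u: "u \<in> L"
  obtains \<sigma> where "field_emb L \<sigma>" "\<sigma> u = v"
proof -
  have "map_poly of_rat p \<noteq> (0 :: complex poly)"
    by (rule irreducible_map_poly_of_rat_nonzero[OF p(1)])
  then obtain m where min: "minimal_poly_over \<rat> u m"
    using minimal_poly_over_exists[OF poly_over_of_rat _ p(2)] by blast
  have "poly m v = 0" by (rule irreducible_rat_minimal[OF p(1,2) min p(3)])
  then have "poly (map_poly (\<lambda>x. x) m) v = 0" by simp
  from emb_extend_simple[OF csubfield_RatsI field_emb_id min this] obtain \<psi>
    where \<psi>: "field_emb (adjoin \<rat> u) \<psi>" "\<psi> u = v" by metis
  have "\<forall>s\<in>S. \<exists>p. poly_over (adjoin \<rat> u) p \<and> p \<noteq> 0 \<and> poly p s = 0"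
    using G S poly_over_mono[OF G(1) adjoin_superset[OF csubfield_RatsI]] by blast
  moreover have "finite S" unfolding S by (rule poly_roots_finite[OF G(2)])
  ultimately obtain E \<sigma> where E: "csubfield E" "field_emb E \<sigma>" "S \<subseteq> E" "\<forall>x\<in>adjoin \<rat> u. \<sigma> x = \<psi> x"
    using emb_extend_finite[OF _ csubfield_adjoin[OF csubfield_RatsI min] \<psi>(1)] by blast
  have "field_emb L \<sigma>"
    using field_emb_subset[OF E(2)] generate_least[OF E(1,3)] L by blast
  moreover have "\<sigma> u = v" using E(4) \<psi>(2) adjoin_generator[OF csubfield_RatsI] by metis
  ultimately show ?thesis by (rule that)
qed

section \<open>Finite dimension over the rationals and algebraic elements\<close>

interpretation rat_vs: vector_space "\<lambda>(q::rat) (x::complex). of_rat q * x"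
  by unfold_locales (simp_all add: algebra_simps of_rat_add of_rat_mult)

text \<open>The products of elements of \<open>B\<close> with the powers of \<alpha> below the
  degree of \<open>m\<close> span the extension.\<close>

lemma adjoin_finite_span:
  assumes K: "csubfield K" and min: "minimal_poly_over K \<alpha> m" and B: "finite B" "K \<subseteq> rat_vs.span B"
  obtains B' where "finite B'" "adjoin K \<alpha> \<subseteq> rat_vs.span B'"
proof -
  define B' where "B' = (\<lambda>(b, i). b * \<alpha> ^ i) ` (B \<times> {..<Polynomial.degree m})"
  have *: "x * \<alpha> ^ i \<in> rat_vs.span B'" if "x \<in> rat_vs.span B" "i < Polynomial.degree m" for x i
    using that(1)
  proof (induction rule: rat_vs.span_induct_alt)
    case base
    then show ?case by (simp add: rat_vs.span_zero)
  next
    case (step c b y)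
    have "b * \<alpha> ^ i \<in> B'" using step that(2) by (auto simp: B'_def)
    then have "of_rat c * (b * \<alpha> ^ i) \<in> rat_vs.span B'"
      by (intro rat_vs.span_scale rat_vs.span_base)
    with step(2) rat_vs.span_add[OF this step(2)] show ?case by (simp add: algebra_simps)
  qed
  have "adjoin K \<alpha> \<subseteq> rat_vs.span B'"
  proof
    fix y assume "y \<in> adjoin K \<alpha>"
    then obtain p where p: "poly_over K p" "y = poly p \<alpha>" "p = 0 \<or> Polynomial.degree p < Polynomial.degree m"
      using adjoin_reduce[OF K min] by blast
    show "y \<in> rat_vs.span B'"
    proof (cases "p = 0")
      case False
      then show ?thesis unfolding p(2) poly_altdef
        using p(1,3) B(2) by (intro rat_vs.span_sum *) (auto simp: poly_over_def)
    qed (use p(2) in \<open>simp add: rat_vs.span_zero\<close>)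
  qed
  moreover have "finite B'" using B(1) by (simp add: B'_def)
  ultimately show ?thesis by (rule that[rotated])
qed

lemma csubfield_finite_span_exists:
  assumes "finite S" "\<forall>\<alpha>\<in>S. \<exists>p. poly_over \<rat> p \<and> p \<noteq> 0 \<and> poly p \<alpha> = 0"
  shows "\<exists>K B. csubfield K \<and> S \<subseteq> K \<and> finite B \<and> K \<subseteq> rat_vs.span B"
  using assms
proof (induction S rule: finite_induct)
  case empty
  have "\<rat> \<subseteq> rat_vs.span {1}"
    by (auto elim!: Rats_cases simp: rat_vs.span_singleton)
  then show ?case using csubfield_RatsI by blast
next
  case (insert \<alpha> S)
  then obtain K B where K: "csubfield K" "S \<subseteq> K" and B: "finite B" "K \<subseteq> rat_vs.span B" by auto
  obtain p where "poly_over \<rat> p" "p \<noteq> 0" "poly p \<alpha> = 0" using insert.prems by blast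
  with poly_over_Rats[OF K(1)] obtain m where min: "minimal_poly_over K \<alpha> m"
    using minimal_poly_over_exists by metis
  obtain B' where "finite B'" "adjoin K \<alpha> \<subseteq> rat_vs.span B'"
    using adjoin_finite_span[OF K(1) min B] by blast
  moreover have "csubfield (adjoin K \<alpha>)" by (rule csubfield_adjoin[OF K(1) min])
  moreover have "insert \<alpha> S \<subseteq> adjoin K \<alpha>"
    using adjoin_superset[OF K(1)] adjoin_generator[OF K(1)] K(2) by blast
  ultimately show ?case by blast
qed

text \<open>The powers of \<open>x\<close> with exponents 0, ..., n are too many to be independent,
  and a linear relation among them is a polynomial. Dependence speaks of sets, so coinciding powers
  form a case of their own, settled by X^i - X^j.\<close>

lemma algebraic_if_finite_span:
  assumes K: "csubfield K" and B: "finite B" "K \<subseteq> rat_vs.span B" and x: "x \<in> K"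
  shows "Polynomial.algebraic x"
proof -
  define n where "n = card B"
  have pow: "x ^ i \<in> K" for i
    by (induction i) (auto simp: csubfield_1[OF K] csubfield_mult[OF K x])
  show ?thesis
  proof (cases "inj_on (\<lambda>i. x ^ i) {..n}")
    case True
    let ?S = "(\<lambda>i. x ^ i) ` {..n}"
    have "card ?S = n + 1" using True by (simp add: card_image)
    then have "rat_vs.dependent ?S"
      using rat_vs.independent_span_bound[OF B(1), of ?S] pow B(2) by (force simp: n_def)
    then obtain u v where u: "v \<in> ?S" "u v \<noteq> 0" "(\<Sum>v\<in>?S. of_rat (u v) * v) = 0"
      by (auto simp: rat_vs.dependent_finite)
    define p where "p = (\<Sum>i\<le>n. Polynomial.monom (of_rat (u (x ^ i)) :: complex) i)"
    have c: "poly.coeff p i = (if i \<le> n then of_rat (u (x ^ i)) else 0)" for i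
      by (simp add: p_def coeff_sum sum.delta)
    obtain j where "j \<le> n" "u (x ^ j) \<noteq> 0" using u by auto
    then have "p \<noteq> 0" using c[of j] by auto
    moreover have "poly p x = 0"
      using u(3) True by (simp add: p_def poly_sum poly_monom sum.reindex)
    moreover have "poly.coeff p i \<in> \<rat>" for i by (simp add: c)
    ultimately show ?thesis by (intro algebraicI')
  next
    case False
    then obtain i j where ij: "i \<noteq> j" "x ^ i = x ^ j" by (auto simp: inj_on_def)
    define p where "p = Polynomial.monom (1 :: complex) i - Polynomial.monom 1 j"
    have "poly.coeff p i \<noteq> 0" using ij by (simp add: p_def)
    then have "p \<noteq> 0" by auto
    then show ?thesis using ij
      by (intro algebraicI'[of p]) (auto simp: p_def poly_monom)
  qed
qed

text \<open>Normality: a conjugate \<open>v\<close> of some \<open>u\<close> in the field is the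
  image of \<open>u\<close> under an embedding, and that embedding maps the field onto
  itself.\<close>

lemma galois_over_rat_generate_roots:
  assumes G: "poly_over \<rat> G" "G \<noteq> 0" and S: "S = {z. poly G z = 0}"
  shows "galois_over_rat (generate_field complex_field S)"
  unfolding galois_over_rat_def
proof (intro conjI ballI allI impI)
  let ?L = "generate_field complex_field S"
  show L: "csubfield ?L" by (rule csubfield_generate)
  have fin: "finite S" unfolding S by (rule poly_roots_finite[OF G(2)])
  obtain K B where K: "csubfield K" "S \<subseteq> K" "finite B" "K \<subseteq> rat_vs.span B"
    using csubfield_finite_span_exists[OF fin] G S by blast
  show "Polynomial.algebraic x" if "x \<in> ?L" for x
    using algebraic_if_finite_span[OF K(1,3,4)] generate_least[OF K(1,2)] that by blast
  fix p :: "rat poly" and v :: complex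
  assume p: "Factorial_Ring.irreducible p \<and> (\<exists>x\<in>?L. poly (map_poly of_rat p) x = 0)"
    and v: "poly (map_poly of_rat p) v = 0"
  then obtain u where u: "u \<in> ?L" "poly (map_poly of_rat p) u = 0" by blast
  obtain \<sigma> where "field_emb ?L \<sigma>" "\<sigma> u = v"
    using conjugation_extends[OF G S refl _ u(2) v u(1)] p by blast
  with emb_generate_roots_surj(2)[OF G S refl] u(1) show "v \<in> ?L" by blast
qed

lemma galois_closure_rat_adjoin:
  assumes p: "Factorial_Ring.irreducible p" "poly (map_poly of_rat p) \<tau> = 0"
  shows "galois_closure (rat_adjoin \<tau>) = generate_field complex_field {z. poly (map_poly of_rat p) z = 0}"
    (is "_ = ?L")
proof
  have nz: "map_poly of_rat p \<noteq> (0 :: complex poly)"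
    by (rule irreducible_map_poly_of_rat_nonzero[OF p(1)])
  have "galois_over_rat ?L" by (rule galois_over_rat_generate_roots[OF poly_over_of_rat nz refl])
  moreover have "\<tau> \<in> ?L" using p(2) by (intro generate_field.incl) simp
  then have "rat_adjoin \<tau> \<subseteq> ?L" unfolding rat_adjoin_def
    by (intro generate_least csubfield_generate) simp
  ultimately show "galois_closure (rat_adjoin \<tau>) \<subseteq> ?L"
    unfolding galois_closure_def by blast
  have "?L \<subseteq> E" if E: "galois_over_rat E" "rat_adjoin \<tau> \<subseteq> E" for E
  proof (rule generate_least)
    show "csubfield E" using E(1) by (simp add: galois_over_rat_def)
    have "\<tau> \<in> rat_adjoin \<tau>" unfolding rat_adjoin_def by (intro generate_field.incl) simp
    then have "\<tau> \<in> E" using E(2) by blast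
    then show "{z. poly (map_poly of_rat p) z = 0} \<subseteq> E"
      using E(1) p unfolding galois_over_rat_def by blast
  qed
  then show "?L \<subseteq> galois_closure (rat_adjoin \<tau>)"
    unfolding galois_closure_def by blast
qed

section \<open>Generating the symmetric group on four points\<close>

lemma atLeastAtMost_1_4: "{1..4::nat} = {1, 2, 3, 4}"
  by auto

lemma permutes_4_values:
  assumes "p permutes {1..4::nat}"
  shows "{p 1, p 2, p 3, p 4} = {1, 2, 3, 4}" "distinct [p 1, p 2, p 3, p 4]"
proof -
  show "{p 1, p 2, p 3, p 4} = {1, 2, 3, 4}"
    using permutes_image[OF assms] unfolding atLeastAtMost_1_4 by simp
  show "distinct [p 1, p 2, p 3, p 4]"
    using permutes_inj[OF assms] by (simp add: inj_eq)
qed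

lemma permutes_4_last:
  assumes "p permutes {1..4::nat}"
  shows "{p 3, p 4} = {1, 2, 3, 4} - {p 1, p 2}"
proof -
  have "{p 3, p 4} = {p 1, p 2, p 3, p 4} - {p 1, p 2}"
    using permutes_4_values(2)[OF assms] by auto
  then show ?thesis unfolding permutes_4_values(1)[OF assms] .
qed

text \<open>For permutations of four points this describes the 3-cycles: the three moved points can
  only be permuted cyclically. In this form it can be checked by evaluation.\<close>

definition one_fixpoint :: "(nat \<Rightarrow> nat) \<Rightarrow> nat \<Rightarrow> bool" where
  "one_fixpoint p a \<longleftrightarrow> p a = a \<and> (\<forall>b\<in>{1..4} - {a}. p b \<noteq> b)"

text \<open>The hypotheses say that \<open>p\<close> and \<open>q\<close> carry the pairing \<open>12|34\<close> to \<open>13|24\<close> and to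
  \<open>14|23\<close>. If neither permutes the three pairings cyclically, then both are transpositions of
  pairings and \<open>p \<circ> q\<close> does.\<close>

lemma one_fixpoint_from_pairings:
  assumes H: "\<And>p. p \<in> H \<Longrightarrow> p permutes {1..4::nat}" "\<And>p q. p \<in> H \<Longrightarrow> q \<in> H \<Longrightarrow> p \<circ> q \<in> H"
    and p: "p \<in> H" "{p 1, p 2} = {1, 3} \<or> {p 1, p 2} = {2, 4}"
    and q: "q \<in> H" "{q 1, q 2} = {1, 4} \<or> {q 1, q 2} = {2, 3}"
  shows "\<exists>r\<in>H. \<exists>a\<in>{1..4}. one_fixpoint r a"
proof -
  have "(\<exists>a\<in>{1..4}. one_fixpoint p a) \<or> (\<exists>a\<in>{1..4}. one_fixpoint q a) \<or>
        (\<exists>a\<in>{1..4}. one_fixpoint (p \<circ> q) a)"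
  proof -
    \<comment> \<open>The values at 1 and 2 determine the set of values at 3 and 4, which leaves
      eight permutations here and eight in \<open>Q\<close>. All 64 combinations are then
      checked.\<close>
    have P: "p 1 = 1 \<and> p 2 = 3 \<and> p 3 = 2 \<and> p 4 = 4 \<or> p 1 = 1 \<and> p 2 = 3 \<and> p 3 = 4 \<and> p 4 = 2
      \<or> p 1 = 3 \<and> p 2 = 1 \<and> p 3 = 2 \<and> p 4 = 4 \<or> p 1 = 3 \<and> p 2 = 1 \<and> p 3 = 4 \<and> p 4 = 2
      \<or> p 1 = 2 \<and> p 2 = 4 \<and> p 3 = 1 \<and> p 4 = 3 \<or> p 1 = 2 \<and> p 2 = 4 \<and> p 3 = 3 \<and> p 4 = 1
      \<or> p 1 = 4 \<and> p 2 = 2 \<and> p 3 = 1 \<and> p 4 = 3 \<or> p 1 = 4 \<and> p 2 = 2 \<and> p 3 = 3 \<and> p 4 = 1"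
    proof -
      have "p 1 = 1 \<and> p 2 = 3 \<or> p 1 = 3 \<and> p 2 = 1 \<or> p 1 = 2 \<and> p 2 = 4 \<or> p 1 = 4 \<and> p 2 = 2"
        using p(2) by (auto simp: doubleton_eq_iff)
      then show ?thesis
        using permutes_4_last[OF H(1)[OF p(1)]]
        by (elim disjE conjE) (simp_all add: insert_Diff_if doubleton_eq_iff)
    qed
    have Q: "q 1 = 1 \<and> q 2 = 4 \<and> q 3 = 2 \<and> q 4 = 3 \<or> q 1 = 1 \<and> q 2 = 4 \<and> q 3 = 3 \<and> q 4 = 2
      \<or> q 1 = 4 \<and> q 2 = 1 \<and> q 3 = 2 \<and> q 4 = 3 \<or> q 1 = 4 \<and> q 2 = 1 \<and> q 3 = 3 \<and> q 4 = 2
      \<or> q 1 = 2 \<and> q 2 = 3 \<and> q 3 = 1 \<and> q 4 = 4 \<or> q 1 = 2 \<and> q 2 = 3 \<and> q 3 = 4 \<and> q 4 = 1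
      \<or> q 1 = 3 \<and> q 2 = 2 \<and> q 3 = 1 \<and> q 4 = 4 \<or> q 1 = 3 \<and> q 2 = 2 \<and> q 3 = 4 \<and> q 4 = 1"
    proof -
      have "q 1 = 1 \<and> q 2 = 4 \<or> q 1 = 4 \<and> q 2 = 1 \<or> q 1 = 2 \<and> q 2 = 3 \<or> q 1 = 3 \<and> q 2 = 2"
        using q(2) by (auto simp: doubleton_eq_iff)
      then show ?thesis
        using permutes_4_last[OF H(1)[OF q(1)]]
        by (elim disjE conjE) (simp_all add: insert_Diff_if doubleton_eq_iff)
    qed
    show ?thesis
      unfolding atLeastAtMost_1_4 one_fixpoint_def
      using P Q by (elim disjE conjE) (simp_all add: insert_Diff_if)
  qed
  with H(2)[OF p(1) q(1)] p(1) q(1) show ?thesis by blast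
qed

text \<open>A nonempty finite subsemigroup of a group is a subgroup: composition with
  \<open>p\<close> is injective on the finite set \<open>H\<close>, hence surjective. Hitting
  \<open>p\<close> gives the identity, and hitting the identity gives the inverse.\<close>

lemma closed_under_comp_inverse:
  assumes H: "\<And>p. p \<in> H \<Longrightarrow> p permutes S" "\<And>p q. p \<in> H \<Longrightarrow> q \<in> H \<Longrightarrow> p \<circ> q \<in> H"
    and S: "finite S" and p: "p \<in> H"
  shows "id \<in> H" "Hilbert_Choice.inv p \<in> H"
proof -
  have fin: "finite H"
    using finite_subset[of H "{p. p permutes S}"] H(1) finite_permutations[OF S] by blast
  have bij: "bij p" using H(1)[OF p] permutes_bij by blast
  have *: "Hilbert_Choice.inv p \<circ> (p \<circ> q) = q" for q
    using bij by (simp add: o_assoc bij_is_inj)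
  then have "inj_on (\<lambda>q. p \<circ> q) H" by (intro inj_on_inverseI[of _ "\<lambda>q. Hilbert_Choice.inv p \<circ> q"])
  moreover have "(\<lambda>q. p \<circ> q) ` H \<subseteq> H" using H(2) p by blast
  ultimately have surj: "(\<lambda>q. p \<circ> q) ` H = H" by (simp add: endo_inj_surj fin)
  obtain q where q: "q \<in> H" "p \<circ> q = p" using surj p by (metis imageE)
  then have "q = id" using *[of q] bij by (simp add: bij_is_inj)
  then show id: "id \<in> H" using q by simp
  then obtain r where r: "r \<in> H" "p \<circ> r = id" using surj by (metis imageE)
  then have "r = Hilbert_Choice.inv p" using *[of r] by simp
  then show "Hilbert_Choice.inv p \<in> H" using r by simp
qed

text \<open>There are only two 3-cycles on given three points, and each is the square of the
  other.\<close>

lemma three_cycle_eq_power: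
  assumes c: "c permutes {1..4::nat}" "one_fixpoint c l"
    and ijkl: "{i, j, k, l} = {1..4::nat}" "distinct [i, j, k, l]"
  shows "cycle_of_list [i, j, k] = c \<or> cycle_of_list [i, j, k] = c \<circ> c"
proof -
  have fp: "c l = l" "c i \<noteq> i" "c j \<noteq> j" "c k \<noteq> k"
    using c(2) ijkl(2) unfolding one_fixpoint_def ijkl(1)[symmetric] by auto
  have inj: "c a = c b \<longleftrightarrow> a = b" for a b
    using permutes_inj[OF c(1)] by (simp add: inj_eq)
  have mem: "c a \<in> {i, j, k, l}" if "a \<in> {i, j, k, l}" for a
    unfolding ijkl(1) using permutes_in_image[OF c(1)] that ijkl(1) by blast
  have out: "c a = a" if "a \<notin> {i, j, k, l}" for a
    using c(1) that unfolding ijkl(1) by (auto simp: permutes_def)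
  have cyc: "cycle_of_list [i, j, k] a = (if a = i then j else if a = j then k else if a = k then i else a)" for a
    using ijkl(2) by (auto simp: Transposition.transpose_def)
  have ne: "c i \<noteq> l" "c j \<noteq> l" "c k \<noteq> l" using inj[of _ l] fp(1) ijkl(2) by auto
  consider "c i = j" "c j = k" "c k = i" | "c i = k" "c k = j" "c j = i"
    using mem[of i] mem[of j] mem[of k] fp ne inj[of i j] inj[of i k] inj[of j k] ijkl(2) by auto
  then show ?thesis
  proof cases
    case 1
    have "cycle_of_list [i, j, k] a = c a" for a
      unfolding cyc using 1 fp(1) out[of a] by (cases "a = l") auto
    then show ?thesis by blast
  next
    case 2
    have "cycle_of_list [i, j, k] a = (c \<circ> c) a" for a
      unfolding cyc using 2 fp(1) out[of a] by (cases "a = l") auto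
    then show ?thesis by blast
  qed
qed

lemma sym_group_4_criterion:
  assumes H: "\<And>p. p \<in> H \<Longrightarrow> p permutes {1..4::nat}" "\<And>p q. p \<in> H \<Longrightarrow> q \<in> H \<Longrightarrow> p \<circ> q \<in> H"
    and trans: "\<And>i j. i \<in> {1..4} \<Longrightarrow> j \<in> {1..4} \<Longrightarrow> \<exists>p\<in>H. p i = j"
    and three: "r \<in> H" "a \<in> {1..4}" "one_fixpoint r a"
    and odd: "s \<in> H" "\<not> evenperm s"
    and p: "p permutes {1..4}"
  shows "p \<in> H"
proof -
  note inv = closed_under_comp_inverse(2)[OF H finite_atLeastAtMost]
  have fix_all: "\<exists>c\<in>H. one_fixpoint c b" if b: "b \<in> {1..4}" for b
  proof -
    obtain h where h: "h \<in> H" "h a = b" using trans[OF three(2) b] by blast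
    note hp = H(1)[OF h(1)]
    \<comment> \<open>Conjugation by \<open>h\<close> carries the unique fixed point
      \<open>a\<close> to \<open>b\<close>.\<close>
    define c where "c = h \<circ> (r \<circ> Hilbert_Choice.inv h)"
    have "c \<in> H" unfolding c_def using H(2) h(1) three(1) inv by blast
    moreover have "one_fixpoint c b"
      unfolding one_fixpoint_def
    proof (intro conjI ballI)
      have ia: "Hilbert_Choice.inv h b = a" using h(2) permutes_inverses(2)[OF hp] by blast
      then show "c b = b" using three(3) h(2) by (simp add: c_def one_fixpoint_def)
      fix y assume y: "y \<in> {1..4} - {b}"
      let ?z = "Hilbert_Choice.inv h y"
      have "h ?z = y" using permutes_inverses(1)[OF hp] by simp
      moreover have "?z \<in> {1..4}" using y permutes_in_image[OF permutes_inv[OF hp]] by blast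
      moreover have "?z \<noteq> a" using \<open>h ?z = y\<close> h(2) y by auto
      ultimately have "r ?z \<noteq> ?z" using three(3) by (simp add: one_fixpoint_def)
      then have "h (r ?z) \<noteq> h ?z" using permutes_inj[OF hp] by (simp add: inj_eq)
      then show "c y \<noteq> y" using \<open>h ?z = y\<close> by (simp add: c_def)
    qed
    ultimately show ?thesis by blast
  qed
  have cycles: "three_cycles 4 \<subseteq> H"
  proof
    fix t assume "t \<in> three_cycles 4"
    then obtain cs where cs: "t = cycle_of_list cs" "cycle cs" "length cs = 3" "set cs \<subseteq> {1..4}"
      by blast
    obtain i j k where ijk: "cs = [i, j, k]" using stupid_lemma[OF cs(3)] by blast
    have "card {i, j, k} = 3" using cs(2) by (simp add: ijk)
    then have "card ({1..4} - {i, j, k}) = 1"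
      using cs(4) card_Diff_subset[of "{i, j, k}" "{1..4}"] by (simp add: ijk)
    then obtain l where l: "{1..4} - {i, j, k} = {l}" by (rule card_1_singletonE)
    have sub: "{i, j, k} \<subseteq> {1..4}" using cs(4) by (simp add: ijk)
    have "{i, j, k, l} = {i, j, k} \<union> ({1..4} - {i, j, k})" unfolding l by blast
    then have l': "{i, j, k, l} = {1..4}" using sub by blast
    have "l \<in> {1..4} - {i, j, k}" unfolding l by simp
    then have l'': "l \<in> {1..4}" "distinct [i, j, k, l]" using cs(2) by (simp_all add: ijk)
    obtain c where c: "c \<in> H" "one_fixpoint c l" using fix_all[OF l''(1)] by blast
    show "t \<in> H"
      using three_cycle_eq_power[OF H(1)[OF c(1)] c(2) l' l''(2)] c(1) H(2)[OF c(1) c(1)]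
      unfolding cs(1) ijk by auto
  qed
  have alt: "carrier (alt_group 4) \<subseteq> H"
  proof
    fix t assume "t \<in> carrier (alt_group 4)"
    then have "t \<in> generate (alt_group 4) (three_cycles 4)"
      by (simp only: alt_group_carrier_as_three_cycles)
    then show "t \<in> H"
    proof (induction rule: generate.induct)
      case one
      then show ?case using closed_under_comp_inverse(1)[OF H finite_atLeastAtMost three(1)]
        by (simp only: alt_group_one)
    next
      case (incl h)
      then show ?case using cycles by blast
    next
      case (inv h)
      then have "inv\<^bsub>alt_group 4\<^esub> h = Hilbert_Choice.inv h"
        using three_cycles_incl by (intro alt_group_inv_equality) blast
      moreover have "h \<in> H" using cycles inv by blast
      ultimately show ?case using closed_under_comp_inverse(2)[OF H finite_atLeastAtMost] by simp
    next
      case (eng h1 h2)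
      then show ?case unfolding alt_group_mult by (intro H(2))
    qed
  qed
  show ?thesis
  proof (cases "evenperm p")
    case True
    with p alt show ?thesis by (auto simp: alt_group_carrier)
  next
    case False
    note sp = H(1)[OF odd(1)]
    have perm: "permutation p" "permutation (Hilbert_Choice.inv s)" "permutation s"
      using p sp permutes_inv[OF sp] by (auto intro: permutes_imp_permutation[OF finite_atLeastAtMost])
    \<comment> \<open>An odd \<open>p\<close> is an even permutation followed on the right by the
      odd \<open>s\<close>.\<close>
    have "evenperm (p \<circ> Hilbert_Choice.inv s)"
      using False odd(2) perm by (simp add: evenperm_comp evenperm_inv)
    moreover have "p \<circ> Hilbert_Choice.inv s permutes {1..4}"
      using p permutes_inv[OF sp] by (rule permutes_compose[rotated])
    ultimately have "p \<circ> Hilbert_Choice.inv s \<in> H" using alt by (auto simp: alt_group_carrier)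
    then have "(p \<circ> Hilbert_Choice.inv s) \<circ> s \<in> H" using H(2) odd(1) by blast
    then show ?thesis using permutes_inv_o(2)[OF sp] by (simp add: comp_assoc)
  qed
qed

section \<open>The square root of the discriminant as an alternating function\<close>

definition pairing_disc :: "(nat \<Rightarrow> complex) \<Rightarrow> complex" where
  "pairing_disc x = (x 1 * x 2 + x 3 * x 4 - (x 1 * x 3 + x 2 * x 4)) *
     (x 1 * x 2 + x 3 * x 4 - (x 1 * x 4 + x 2 * x 3)) *
     (x 1 * x 3 + x 2 * x 4 - (x 1 * x 4 + x 2 * x 3))"

definition vandermonde4 :: "complex \<Rightarrow> complex \<Rightarrow> complex \<Rightarrow> complex \<Rightarrow> complex" where
  "vandermonde4 a b c d = (a - b) * (a - c) * (a - d) * (b - c) * (b - d) * (c - d)"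

text \<open>Each difference of two pairings splits into two differences of roots, and the six root
  differences occur once each. Hence a quartic and its resolvent cubic have the same
  discriminant.\<close>

lemma pairing_disc_eq_vandermonde4: "pairing_disc x = vandermonde4 (x 1) (x 2) (x 3) (x 4)"
proof -
  have "x 1 * x 2 + x 3 * x 4 - (x 1 * x 3 + x 2 * x 4) = (x 1 - x 4) * (x 2 - x 3)"
    "x 1 * x 2 + x 3 * x 4 - (x 1 * x 4 + x 2 * x 3) = (x 1 - x 3) * (x 2 - x 4)"
    "x 1 * x 3 + x 2 * x 4 - (x 1 * x 4 + x 2 * x 3) = (x 1 - x 2) * (x 3 - x 4)"
    by (simp_all add: algebra_simps)
  then show ?thesis unfolding pairing_disc_def vandermonde4_def by (simp add: mult_ac)
qed

lemma vandermonde4_swaps: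
  "vandermonde4 b a c d = - vandermonde4 a b c d" "vandermonde4 a c b d = - vandermonde4 a b c d"
  "vandermonde4 a b d c = - vandermonde4 a b c d" "vandermonde4 c b a d = - vandermonde4 a b c d"
  "vandermonde4 a d c b = - vandermonde4 a b c d" "vandermonde4 d b c a = - vandermonde4 a b c d"
proof -
  \<comment> \<open>Every difference gets one fixed orientation, so that only signs and the order of
    factors remain to be compared.\<close>
  have sw: "b - a = - (a - b)" "c - a = - (a - c)" "d - a = - (a - d)" "c - b = - (b - c)"
    "d - b = - (b - d)" "d - c = - (c - d)"
    by simp_all
  show "vandermonde4 b a c d = - vandermonde4 a b c d" "vandermonde4 a c b d = - vandermonde4 a b c d"
    "vandermonde4 a b d c = - vandermonde4 a b c d" "vandermonde4 c b a d = - vandermonde4 a b c d"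
    "vandermonde4 a d c b = - vandermonde4 a b c d" "vandermonde4 d b c a = - vandermonde4 a b c d"
    unfolding vandermonde4_def
    by (simp_all only: sw mult_minus_left mult_minus_right minus_minus mult_ac)
qed

lemma pairing_disc_transpose:
  assumes "a \<in> {1..4}" "b \<in> {1..4}" "a \<noteq> b"
  shows "pairing_disc (x \<circ> Transposition.transpose a b) = - pairing_disc x"
  using assms unfolding atLeastAtMost_1_4 insert_iff empty_iff pairing_disc_eq_vandermonde4
  by (elim disjE) (simp_all add: Transposition.transpose_def, (rule vandermonde4_swaps)+)

text \<open>Used to read off parity: an automorphism that negates a nonzero
  \<open>pairing_disc\<close> of the roots must permute them oddly.\<close>

lemma pairing_disc_permute:
  assumes "p permutes {1..4}"
  shows "pairing_disc (x \<circ> p) = of_int (sign p) * pairing_disc x"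
  using finite_atLeastAtMost assms
proof (induction p rule: permutes_rev_induct)
  case (swap a b p)
  have "permutation p" by (rule permutes_imp_permutation[OF finite_atLeastAtMost]) fact
  then have sgn: "sign (p \<circ> Transposition.transpose a b) = - sign p"
    using swap.hyps by (simp add: sign_compose sign_swap_id permutation_swap_id)
  have "pairing_disc (x \<circ> (p \<circ> Transposition.transpose a b)) = - pairing_disc (x \<circ> p)"
    unfolding comp_assoc[symmetric] by (rule pairing_disc_transpose) fact+
  then show ?case by (simp only: sgn swap.IH of_int_minus mult_minus_left)
qed (simp add: sign_id)

section \<open>Automorphisms as permutations of the roots\<close>

lemma galois_group_carrier_iff:
  assumes L: "csubfield L"
  shows "\<sigma> \<in> carrier (galois_group L) \<longleftrightarrow> \<sigma> \<in> Bij L \<and> field_emb L \<sigma>"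
proof -
  have "\<sigma> q = q" if "field_emb L \<sigma>" "q \<in> \<rat>" for q
    using emb_Rats[OF L that] .
  moreover have "\<sigma> \<in> ring_hom (complex_field\<lparr>carrier := L\<rparr>) (complex_field\<lparr>carrier := L\<rparr>) \<longleftrightarrow> field_emb L \<sigma>"
    if "\<sigma> \<in> L \<rightarrow> L"
    using that unfolding ring_hom_def field_emb_def by (simp add: Pi_iff) metis
  moreover have "\<sigma> \<in> L \<rightarrow> L" if "\<sigma> \<in> Bij L" using that by (rule Bij_imp_funcset)
  ultimately show ?thesis unfolding galois_group_def by (simp, blast)
qed

lemma galois_group_mult:
  "\<sigma> \<in> Bij L \<Longrightarrow> \<tau> \<in> Bij L \<Longrightarrow> \<sigma> \<otimes>\<^bsub>galois_group L\<^esub> \<tau> = compose L \<sigma> \<tau>"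
  by (simp add: galois_group_def BijGroup_def)

lemma field_emb_cong: "csubfield L \<Longrightarrow> (\<And>y. y \<in> L \<Longrightarrow> \<sigma> y = \<tau> y) \<Longrightarrow> field_emb L \<sigma> \<Longrightarrow> field_emb L \<tau>"
  unfolding field_emb_def by (metis csubfield_1 csubfield_add csubfield_mult)

text \<open>The roots are numbered by \<open>x\<close>, and \<open>inv_into\<close> recovers the
  index of the image root. Indices outside \<open>{1..n}\<close> are fixed, as
  \<open>permutes\<close> demands.\<close>

definition root_perm :: "nat \<Rightarrow> (nat \<Rightarrow> complex) \<Rightarrow> (complex \<Rightarrow> complex) \<Rightarrow> nat \<Rightarrow> nat" where
  "root_perm n x \<sigma> i = (if i \<in> {1..n} then inv_into {1..n} x (\<sigma> (x i)) else i)"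

context
  fixes G :: "complex poly" and S :: "complex set" and n :: nat and x :: "nat \<Rightarrow> complex" and L :: "complex set"
  assumes G: "poly_over \<rat> G" "G \<noteq> 0" and S: "S = {z. poly G z = 0}"
    and x: "bij_betw x {1..n} S" and L: "L = generate_field complex_field S"
begin

lemma csubfield_L: "csubfield L"
  unfolding L by (rule csubfield_generate)

lemma root_in_L: "i \<in> {1..n} \<Longrightarrow> x i \<in> L"
  using x bij_betwE generate_superset unfolding L by blast

lemma root_perm_eq:
  assumes "field_emb L \<sigma>" "i \<in> {1..n}"
  shows "root_perm n x \<sigma> i \<in> {1..n}" "x (root_perm n x \<sigma> i) = \<sigma> (x i)"
proof -
  have im: "x ` {1..n} = S" using x by (rule bij_betw_imp_surj_on)
  have "\<sigma> (x i) \<in> x ` {1..n}"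
    using emb_generate_roots_surj(1)[OF G S L assms(1)] assms(2) im by blast
  then show "root_perm n x \<sigma> i \<in> {1..n}" "x (root_perm n x \<sigma> i) = \<sigma> (x i)"
    using assms(2) unfolding root_perm_def by (simp_all only: inv_into_into f_inv_into_f if_True)
qed

lemma root_perm_unique:
  assumes "field_emb L \<sigma>" "i \<in> {1..n}" "j \<in> {1..n}" "\<sigma> (x i) = x j"
  shows "root_perm n x \<sigma> i = j"
  using bij_betw_imp_inj_on[OF x] root_perm_eq[OF assms(1,2)] assms(3,4) by (metis inj_onD)

lemma root_perm_permutes:
  assumes emb: "field_emb L \<sigma>"
  shows "root_perm n x \<sigma> permutes {1..n}"
proof (rule bij_imp_permutes)
  have inj: "inj_on (root_perm n x \<sigma>) {1..n}"
  proof (rule inj_onI)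
    fix i j assume ij: "i \<in> {1..n}" "j \<in> {1..n}" "root_perm n x \<sigma> i = root_perm n x \<sigma> j"
    then have "\<sigma> (x i) = \<sigma> (x j)" using root_perm_eq(2)[OF emb] by metis
    then have "x i = x j"
      using emb_inj_on[OF csubfield_L emb] root_in_L ij(1,2) by (metis inj_onD)
    then show "i = j" using bij_betw_imp_inj_on[OF x] ij by (metis inj_onD)
  qed
  moreover have "root_perm n x \<sigma> ` {1..n} \<subseteq> {1..n}" using root_perm_eq(1)[OF emb] by blast
  ultimately show "bij_betw (root_perm n x \<sigma>) {1..n} {1..n}"
    by (simp add: bij_betw_def endo_inj_surj)
qed (auto simp: root_perm_def)

lemma root_perm_comp:
  assumes \<sigma>: "field_emb L \<sigma>" and \<tau>: "field_emb L \<tau>"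
  shows "field_emb L (\<sigma> \<circ> \<tau>)" "root_perm n x (\<sigma> \<circ> \<tau>) = root_perm n x \<sigma> \<circ> root_perm n x \<tau>"
proof -
  have \<tau>L: "\<tau> y \<in> L" if "y \<in> L" for y using emb_generate_roots_surj(2)[OF G S L \<tau>] that by blast
  show emb: "field_emb L (\<sigma> \<circ> \<tau>)"
    using \<sigma> \<tau> \<tau>L unfolding field_emb_def by simp
  show "root_perm n x (\<sigma> \<circ> \<tau>) = root_perm n x \<sigma> \<circ> root_perm n x \<tau>"
  proof
    fix i
    show "root_perm n x (\<sigma> \<circ> \<tau>) i = (root_perm n x \<sigma> \<circ> root_perm n x \<tau>) i"
    proof (cases "i \<in> {1..n}")
      case True
      note j = root_perm_eq[OF \<tau> True]
      note k = root_perm_eq[OF \<sigma> j(1)]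
      show ?thesis using root_perm_unique[OF emb True k(1)] k(2) j(2) by simp
    qed (auto simp: root_perm_def)
  qed
qed

lemma root_perm_cong:
  "(\<And>y. y \<in> L \<Longrightarrow> \<sigma> y = \<tau> y) \<Longrightarrow> root_perm n x \<sigma> = root_perm n x \<tau>"
  using root_in_L by (auto simp: root_perm_def fun_eq_iff)

text \<open>Injectivity holds because the roots generate \<open>L\<close> and group elements are
  extensional on \<open>L\<close>; surjectivity is the assumption \<open>full\<close>, to be
  supplied by the study of the particular polynomial.\<close>

lemma galois_group_iso_sym_group:
  assumes full: "\<And>p. p permutes {1..n} \<Longrightarrow> \<exists>\<sigma>. field_emb L \<sigma> \<and> root_perm n x \<sigma> = p"
  shows "galois_group L \<cong> sym_group n"
proof -
  note carr = galois_group_carrier_iff[OF csubfield_L]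
  have "root_perm n x \<in> hom (galois_group L) (sym_group n)"
  proof (rule homI)
    fix \<sigma> assume "\<sigma> \<in> carrier (galois_group L)"
    then show "root_perm n x \<sigma> \<in> carrier (sym_group n)"
      using root_perm_permutes by (simp add: carr sym_group_carrier)
  next
    fix \<sigma> \<tau> assume *: "\<sigma> \<in> carrier (galois_group L)" "\<tau> \<in> carrier (galois_group L)"
    have "root_perm n x (compose L \<sigma> \<tau>) = root_perm n x (\<sigma> \<circ> \<tau>)"
      by (rule root_perm_cong) (simp add: compose_def)
    then show "root_perm n x (\<sigma> \<otimes>\<^bsub>galois_group L\<^esub> \<tau>) =
        root_perm n x \<sigma> \<otimes>\<^bsub>sym_group n\<^esub> root_perm n x \<tau>"
      using * root_perm_comp(2) by (simp add: carr galois_group_mult sym_group_mult)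
  qed
  moreover have "inj_on (root_perm n x) (carrier (galois_group L))"
  proof (rule inj_onI)
    fix \<sigma> \<tau>
    assume *: "\<sigma> \<in> carrier (galois_group L)" "\<tau> \<in> carrier (galois_group L)"
      "root_perm n x \<sigma> = root_perm n x \<tau>"
    then have emb: "field_emb L \<sigma>" "field_emb L \<tau>" by (simp_all add: carr)
    have "\<sigma> s = \<tau> s" if "s \<in> S" for s
    proof -
      obtain i where "i \<in> {1..n}" "s = x i" using x \<open>s \<in> S\<close> by (metis bij_betw_imp_surj_on imageE)
      then show ?thesis using root_perm_eq(2)[OF emb(1)] root_perm_eq(2)[OF emb(2)] *(3) by metis
    qed
    then have "\<sigma> y = \<tau> y" if "y \<in> L" for y
      using emb_eqI_generate emb that unfolding L by blast
    then show "\<sigma> = \<tau>"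
      using *(1,2) Bij_imp_extensional extensionalityI carr by metis
  qed
  moreover have "carrier (sym_group n) \<subseteq> root_perm n x ` carrier (galois_group L)"
  proof
    fix p assume "p \<in> carrier (sym_group n)"
    then obtain \<sigma> where \<sigma>: "field_emb L \<sigma>" "root_perm n x \<sigma> = p"
      using full by (auto simp: sym_group_carrier)
    \<comment> \<open>Group elements have to be extensional; \<open>root_perm\<close> sees only
      values on \<open>L\<close>, so restricting does not change the permutation.\<close>
    have "restrict \<sigma> L \<in> Bij L"
      using emb_inj_on[OF csubfield_L \<sigma>(1)] emb_generate_roots_surj(2)[OF G S L \<sigma>(1)]
      by (simp add: Bij_def bij_betw_def inj_on_def)
    moreover have "field_emb L (restrict \<sigma> L)"
      by (rule field_emb_cong[OF csubfield_L _ \<sigma>(1)]) simp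
    moreover have "root_perm n x (restrict \<sigma> L) = p"
      unfolding \<sigma>(2)[symmetric] by (rule root_perm_cong) simp
    ultimately show "p \<in> root_perm n x ` carrier (galois_group L)"
      using carr by blast
  qed
  ultimately have "root_perm n x \<in> iso (galois_group L) (sym_group n)"
    unfolding iso_def bij_betw_def hom_def by blast
  then show ?thesis unfolding is_iso_def by blast
qed

end

section \<open>The resolvent cubic\<close>

lemma g_poly_eq: "g_poly c d = [:d, 0, 0, c, 1:]"
  by (simp add: g_poly_def monom_altdef numeral_eq_Suc)

lemma map_g_poly: "map_poly of_int (g_poly c d) = [:of_int d, 0, 0, of_int c, 1:]"
  by (simp add: g_poly_eq map_poly_pCons)

lemma rational_root_int:
  fixes r :: rat
  assumes "poly p r = 0" "lead_coeff p = 1" "\<And>i. poly.coeff p i \<in> \<int>"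
  obtains k :: int where "r = of_int k"
proof -
  have "algebraic_int r" using assms by (intro algebraic_int.intros[of p]) auto
  then have "r \<in> \<int>" by (rule rational_algebraic_int_is_int) (simp add: Rats_def)
  then show ?thesis using that by (auto elim: Ints_cases)
qed

lemma resolvent_no_rat_root:
  fixes r :: rat and d :: int
  assumes "d \<noteq> 0"
  shows "r ^ 3 - 4 * of_int d * r - of_int d \<noteq> 0"
proof
  assume eq: "r ^ 3 - 4 * of_int d * r - of_int d = 0"
  have root: "poly [:- of_int d, - 4 * of_int d, 0, 1:] r = 0"
    using eq by (simp add: algebra_simps power3_eq_cube)
  have int: "poly.coeff [:- of_int d, - 4 * of_int d, 0, 1:] i \<in> (\<int> :: rat set)" for i
    by (auto simp: coeff_pCons split: nat.splits)
  obtain y :: int where y: "r = of_int y"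
    by (rule rational_root_int[OF root _ int]) simp
  have "of_int (y ^ 3) = (of_int (d * (4 * y + 1)) :: rat)"
    using eq by (simp add: y algebra_simps)
  then have y3: "y ^ 3 = d * (4 * y + 1)" by (simp only: of_int_eq_iff)
  have "Rings.coprime (4 * y + 1) y"
  proof (rule coprimeI)
    fix c assume "c dvd 4 * y + 1" "c dvd y"
    then show "is_unit c" by (metis dvd_add_right_iff dvd_mult)
  qed
  then have "Rings.coprime (4 * y + 1) (y ^ 3)" by simp
  then have "is_unit (4 * y + 1)" using y3 by (metis coprime_absorb_left dvd_triv_right)
  then have "4 * y + 1 = 1 \<or> 4 * y + 1 = -1" by auto
  then have "y = 0" by presburger
  then show False using y3 assms by simp
qed

lemma disc_not_rat_square:
  fixes r :: rat and d :: int
  shows "r ^ 2 \<noteq> 256 * of_int d - 27"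
proof
  assume eq: "r ^ 2 = 256 * of_int d - 27"
  have root: "poly [:27 - 256 * of_int d, 0, 1:] r = 0"
    using eq by (simp add: algebra_simps power2_eq_square)
  have int: "poly.coeff [:27 - 256 * of_int d, 0, 1:] i \<in> (\<int> :: rat set)" for i
    by (auto simp: coeff_pCons split: nat.splits)
  obtain k :: int where k: "r = of_int k"
    by (rule rational_root_int[OF root _ int]) simp
  have "of_int (k ^ 2) = (of_int (256 * d - 27) :: rat)" using eq by (simp add: k)
  then have k2: "k ^ 2 = 256 * d - 27" by (simp only: of_int_eq_iff)
  have "256 * d - 27 = 5 + 8 * (32 * d - 4)" by simp
  then have "k ^ 2 mod 8 = 5" unfolding k2 by (simp only: mod_mult_self2) simp
  moreover have "k ^ 2 mod 8 = (k mod 8) ^ 2 mod 8" by (rule power_mod[symmetric])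
  moreover have "k mod 8 \<in> {0, 1, 2, 3, 4, 5, 6, 7}"
    using pos_mod_sign[of 8 k] pos_mod_bound[of 8 k] by auto
  ultimately show False by auto
qed

lemma irreducible_rat_small_degree:
  fixes p :: "rat poly"
  assumes deg: "Polynomial.degree p = 2 \<or> Polynomial.degree p = 3" and nr: "\<And>r. poly p r \<noteq> 0"
  shows "Factorial_Ring.irreducible p"
proof (rule Factorial_Ring.irreducibleI)
  show nz: "p \<noteq> 0" using deg by auto
  show "\<not> is_unit p" using deg unfolding is_unit_iff_degree[OF nz] by auto
  fix a b assume ab: "p = a * b"
  have lin: "Polynomial.degree q \<noteq> 1" if "q dvd p" for q
  proof
    assume "Polynomial.degree q = 1"
    then obtain c e where q: "q = [:c, e:]" "e \<noteq> 0" by (metis degree1_coeffs)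
    then have "poly q (- c / e) = 0" by simp
    then show False using that nr by (metis dvdE mult_zero_left poly_mult)
  qed
  have nz: "a \<noteq> 0" "b \<noteq> 0" using ab deg by auto
  have "Polynomial.degree a \<noteq> 1" "Polynomial.degree b \<noteq> 1" using lin ab by simp_all
  moreover have "Polynomial.degree a + Polynomial.degree b = Polynomial.degree p"
    using nz unfolding ab by (simp add: degree_mult_eq)
  ultimately have "Polynomial.degree a = 0 \<or> Polynomial.degree b = 0" using deg by arith
  then show "is_unit a \<or> is_unit b" using nz by (simp add: is_unit_iff_degree)
qed

lemma complex_quartic_roots:
  fixes p :: "complex poly"
  assumes "Polynomial.degree p = 4" "lead_coeff p = 1"
  obtains a b c e where "p = [:-a, 1:] * [:-b, 1:] * [:-c, 1:] * [:-e, 1:]"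
proof -
  have "p \<noteq> 0" using assms by auto
  from alg_closed_imp_factorization[OF this] obtain A
    where A: "size A = 4" "p = (\<Prod>x\<in>#A. [:-x, 1:])" using assms by auto
  obtain xs where xs: "mset xs = A" using ex_mset by blast
  then have "length xs = 4" using A(1) by auto
  then obtain a b c e where "xs = [a, b, c, e]" by (auto simp: numeral_eq_Suc length_Suc_conv)
  then have "A = {#a, b, c, e#}" using xs by simp
  then have "p = [:-a, 1:] * [:-b, 1:] * [:-c, 1:] * [:-e, 1:]"
    using A(2) by (simp only: image_mset_add_mset prod_mset.add_mset image_mset_empty prod_mset_empty
        mult_1_right mult.assoc)
  then show ?thesis by (rule that)
qed

text \<open>In terms of the elementary symmetric functions e1, ..., e4 of the roots, those of the
  pairings are e2, e1 e3 - 4 e4 and e1^2 e4 + e3^2 - 4 e2 e4. Here e1 = -1 and e2 = e3 = 0.\<close>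

lemma resolvent_relations:
  fixes a b c e d :: complex
  assumes "a + b + c + e = -1" "a * b + a * c + a * e + b * c + b * e + c * e = 0"
    "a * b * c + a * b * e + a * c * e + b * c * e = 0" "a * b * c * e = d"
  defines "t1 \<equiv> a * b + c * e" and "t2 \<equiv> a * c + b * e" and "t3 \<equiv> a * e + b * c"
  shows "t1 + t2 + t3 = 0" "t1 * t2 + t1 * t3 + t2 * t3 = - 4 * d" "t1 * t2 * t3 = d"
proof -
  show "t1 + t2 + t3 = 0" using assms(2) unfolding t1_def t2_def t3_def by (simp add: algebra_simps)
  have "t1 * t2 + t1 * t3 + t2 * t3 = (a + b + c + e) * (a * b * c + a * b * e + a * c * e + b * c * e) - 4 * (a * b * c * e)"
    unfolding t1_def t2_def t3_def by (simp add: algebra_simps)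
  then show "t1 * t2 + t1 * t3 + t2 * t3 = - 4 * d" using assms by simp
  have "t1 * t2 * t3 = (a + b + c + e)^2 * (a * b * c * e) + (a * b * c + a * b * e + a * c * e + b * c * e)^2
      - 4 * (a * b + a * c + a * e + b * c + b * e + c * e) * (a * b * c * e)"
    unfolding t1_def t2_def t3_def power2_eq_square by (simp add: algebra_simps)
  then show "t1 * t2 * t3 = d" using assms by simp
qed

text \<open>The formula -4 p^3 - 27 q^2 for the discriminant of y^3 + p y + q, with p = -4 d and q =
  -d.\<close>

lemma cubic_discriminant:
  fixes t1 t2 t3 d :: complex
  assumes "t1 + t2 + t3 = 0" "t1 * t2 + t1 * t3 + t2 * t3 = - 4 * d" "t1 * t2 * t3 = d"
  shows "((t1 - t2) * (t1 - t3) * (t2 - t3))\<^sup>2 = d\<^sup>2 * (256 * d - 27)"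
proof -
  have t3: "t3 = - t1 - t2" using assms(1) by (simp add: eq_neg_iff_add_eq_0 algebra_simps)
  have "((t1 - t2) * (t1 - t3) * (t2 - t3))\<^sup>2 =
      - 4 * (t1 * t2 + t1 * t3 + t2 * t3) ^ 3 - 27 * (t1 * t2 * t3)\<^sup>2"
    unfolding t3 power2_eq_square power3_eq_cube by (simp add: algebra_simps)
  also have "\<dots> = d\<^sup>2 * (256 * d - 27)"
    unfolding assms(2,3) by (simp add: power2_eq_square power3_eq_cube algebra_simps)
  finally show ?thesis .
qed

lemma cubic_root:
  fixes t1 t2 t3 d :: complex
  assumes "t1 + t2 + t3 = 0" "t1 * t2 + t1 * t3 + t2 * t3 = - 4 * d" "t1 * t2 * t3 = d"
  shows "t1 ^ 3 - 4 * d * t1 - d = 0"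
proof -
  have "t1 ^ 3 - 4 * d * t1 - d = t1 ^ 3 + (t1 * t2 + t1 * t3 + t2 * t3) * t1 - t1 * t2 * t3"
    using assms(2,3) by simp
  also have "\<dots> = t1\<^sup>2 * (t1 + t2 + t3)" by (simp add: power2_eq_square power3_eq_cube algebra_simps)
  finally show ?thesis using assms(1) by simp
qed

text \<open>Couples the action on pairings with its numerical value: when the three values are
  distinct, the value tells which pairing is the image of 12|34.\<close>

lemma pairing_value:
  assumes p: "p permutes {1..4::nat}"
  fixes x :: "nat \<Rightarrow> complex"
  shows "({p 1, p 2} = {1, 2} \<or> {p 1, p 2} = {3, 4}) \<and> x (p 1) * x (p 2) + x (p 3) * x (p 4) = x 1 * x 2 + x 3 * x 4 \<or>
     ({p 1, p 2} = {1, 3} \<or> {p 1, p 2} = {2, 4}) \<and> x (p 1) * x (p 2) + x (p 3) * x (p 4) = x 1 * x 3 + x 2 * x 4 \<or>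
     ({p 1, p 2} = {1, 4} \<or> {p 1, p 2} = {2, 3}) \<and> x (p 1) * x (p 2) + x (p 3) * x (p 4) = x 1 * x 4 + x 2 * x 3"
proof -
  have "p 1 \<in> {1, 2, 3, 4}" "p 2 \<in> {1, 2, 3, 4}" using permutes_4_values(1)[OF p] by blast+
  then have m: "p 1 = 1 \<or> p 1 = 2 \<or> p 1 = 3 \<or> p 1 = 4" "p 2 = 1 \<or> p 2 = 2 \<or> p 2 = 3 \<or> p 2 = 4" by simp_all
  have "p 1 \<noteq> p 2" using permutes_4_values(2)[OF p] by simp
  with m permutes_4_last[OF p] show ?thesis
    by (elim disjE) (auto simp: insert_Diff_if doubleton_eq_iff mult_ac add_ac)
qed

section \<open>The Galois group of the quartic\<close>

lemma emb_pairing_disc: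
  assumes L: "csubfield L" and emb: "field_emb L \<sigma>" and x: "\<And>i. i \<in> {1..4} \<Longrightarrow> x i \<in> L"
  shows "\<sigma> (pairing_disc x) = pairing_disc (\<lambda>i. \<sigma> (x i))" "pairing_disc x \<in> L"
proof -
  have mem: "x 1 \<in> L" "x 2 \<in> L" "x 3 \<in> L" "x 4 \<in> L" by (rule x; simp)+
  show "\<sigma> (pairing_disc x) = pairing_disc (\<lambda>i. \<sigma> (x i))"
    unfolding pairing_disc_def
    by (simp only: mem emb_mult[OF L emb] emb_add[OF L emb] emb_diff[OF L emb]
        csubfield_add[OF L] csubfield_mult[OF L] csubfield_diff[OF L])
  show "pairing_disc x \<in> L"
    unfolding pairing_disc_def
    by (intro csubfield_add[OF L] csubfield_mult[OF L] csubfield_diff[OF L] mem)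
qed

lemma quartic_has_galois_group_sym_group:
  fixes d :: int and \<tau> :: complex
  assumes irr: "Factorial_Ring.irreducible (map_poly of_int (g_poly 1 d) :: rat poly)"
    and \<tau>: "poly (map_poly of_int (g_poly 1 d)) \<tau> = 0" and d: "d \<noteq> 0"
  shows "has_galois_group (rat_adjoin \<tau>) (sym_group 4)"
proof -
  define p :: "rat poly" where "p = map_poly of_int (g_poly 1 d)"
  define G :: "complex poly" where "G = map_poly of_rat p"
  have G_eq: "G = [:of_int d, 0, 0, 1, 1:]"
    by (simp add: G_def p_def map_g_poly map_poly_pCons)
  have G_int: "G = map_poly of_int (g_poly 1 d)" by (simp add: G_eq map_g_poly)
  have G: "poly_over \<rat> G" "G \<noteq> 0" by (simp_all add: G_def poly_over_of_rat) (simp add: G_eq flip: G_def)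
  define S where "S = {z. poly G z = 0}"
  define L where "L = generate_field complex_field S"
  have L: "csubfield L" unfolding L_def by (rule csubfield_generate)
  have "Polynomial.degree G = 4" "lead_coeff G = 1" by (simp_all add: G_eq)
  then obtain a b c e where fac: "G = [:-a, 1:] * [:-b, 1:] * [:-c, 1:] * [:-e, 1:]"
    by (rule complex_quartic_roots)
  then have "a * b * c * e = of_int d \<and> a * b * c + a * b * e + a * c * e + b * c * e = 0 \<and>
      a * b + a * c + a * e + b * c + b * e + c * e = 0 \<and> - (a + b + c + e) = 1"
    unfolding G_eq by (simp add: algebra_simps)
  then have vieta: "a + b + c + e = -1" "a * b + a * c + a * e + b * c + b * e + c * e = 0"
    "a * b * c + a * b * e + a * c * e + b * c * e = 0" "a * b * c * e = of_int d"
    by (metis minus_minus)+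
  define x where "x i = (if i = 1 then a else if i = 2 then b else if i = 3 then c else e)" for i :: nat
  have x_simps: "x 1 = a" "x 2 = b" "x 3 = c" "x 4 = e" by (simp_all add: x_def)
  define t1 where "t1 = a * b + c * e"
  define t2 where "t2 = a * c + b * e"
  define t3 where "t3 = a * e + b * c"
  note t = resolvent_relations[OF vieta, folded t1_def t2_def t3_def]
  \<comment> \<open>The same relations with \<open>t2\<close> or \<open>t3\<close> in first place,
    so that \<open>cubic_root\<close> covers all three pairings.\<close>
  have t': "t2 + t1 + t3 = 0" "t2 * t1 + t2 * t3 + t1 * t3 = - 4 * of_int d" "t2 * t1 * t3 = of_int d"
    "t3 + t1 + t2 = 0" "t3 * t1 + t3 * t2 + t1 * t2 = - 4 * of_int d" "t3 * t1 * t2 = of_int d"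
    using t by (simp_all add: mult_ac add_ac)
  define D where "D = pairing_disc x"
  have D_t: "D = (t1 - t2) * (t1 - t3) * (t2 - t3)"
    unfolding D_def pairing_disc_def x_simps t1_def t2_def t3_def ..
  have D2: "D\<^sup>2 = (of_int d)\<^sup>2 * (256 * of_int d - 27)"
    unfolding D_t by (rule cubic_discriminant[OF t])
  \<comment> \<open>An odd number is nonzero. Hence \<open>D\<close> is nonzero, which separates the
    three pairings and, through \<open>vandermonde4\<close>, the four roots.\<close>
  have disc_int: "256 * d - 27 \<noteq> 0" by presburger
  have "D\<^sup>2 = of_int (d\<^sup>2 * (256 * d - 27))" unfolding D2 by simp
  moreover have "of_int (d\<^sup>2 * (256 * d - 27)) \<noteq> (0 :: complex)"
    unfolding of_int_eq_0_iff using d disc_int by simp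
  ultimately have D_nz: "D \<noteq> 0" by auto
  then have t_ne: "t1 \<noteq> t2" "t1 \<noteq> t3" "t2 \<noteq> t3" by (auto simp: D_t)
  have "vandermonde4 a b c e \<noteq> 0"
    using D_nz unfolding D_def pairing_disc_eq_vandermonde4 x_simps .
  then have dist: "distinct [a, b, c, e]" by (auto simp: vandermonde4_def)
  have "poly G z = (z - a) * (z - b) * (z - c) * (z - e)" for z
    unfolding fac poly_mult by simp
  then have "S = {a, b, c, e}" unfolding S_def by auto
  then have x_im: "x ` {1..4} = S"
    unfolding atLeastAtMost_1_4 by (simp only: image_insert image_empty x_simps)
  have x_inj: "inj_on x {1..4}"
    unfolding atLeastAtMost_1_4 using dist by (auto simp: x_def inj_on_def)
  have x_bij: "bij_betw x {1..4} S" using x_im x_inj by (simp add: bij_betw_def)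
  note perm_eq = root_perm_eq[OF G S_def x_bij L_def]
  note in_L = root_in_L[OF G S_def x_bij L_def]
  \<comment> \<open>Closure under composition is all that will be proved about \<open>H\<close>;
    finiteness makes it a group.\<close>
  define H where "H = root_perm 4 x ` {\<sigma>. field_emb L \<sigma>}"
  have H_perm: "q permutes {1..4}" if "q \<in> H" for q
    using that root_perm_permutes[OF G S_def x_bij L_def] unfolding H_def by blast
  have H_comp: "q \<circ> r \<in> H" if "q \<in> H" "r \<in> H" for q r
    using that root_perm_comp[OF G S_def x_bij L_def] unfolding H_def by (auto simp flip: root_perm_comp(2)[OF G S_def x_bij L_def])
  note conj = conjugation_extends[OF G S_def L_def]
  have H_trans: "\<exists>q\<in>H. q i = j" if ij: "i \<in> {1..4}" "j \<in> {1..4}" for i j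
  proof -
    have "poly G (x i) = 0" "poly G (x j) = 0" using x_im S_def ij by blast+
    then obtain \<sigma> where \<sigma>: "field_emb L \<sigma>" "\<sigma> (x i) = x j"
      using conj[OF irr, folded p_def G_def, of "x i" "x j"] in_L[OF ij(1)] by metis
    then have "root_perm 4 x \<sigma> i = j" by (rule root_perm_unique[OF G S_def x_bij L_def _ ij])
    with \<sigma>(1) show ?thesis unfolding H_def by blast
  qed
  have mem: "x 1 \<in> L" "x 2 \<in> L" "x 3 \<in> L" "x 4 \<in> L" by (rule in_L; simp)+
  have mem_t1: "t1 \<in> L"
    using csubfield_add[OF L] csubfield_mult[OF L] mem unfolding t1_def x_simps by blast
  define R :: "rat poly" where "R = [:- of_int d, - 4 * of_int d, 0, 1:]"
  have R_irr: "Factorial_Ring.irreducible R"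
  proof (rule irreducible_rat_small_degree)
    fix r :: rat
    show "poly R r \<noteq> 0"
      using resolvent_no_rat_root[OF d, of r] by (simp add: R_def algebra_simps power3_eq_cube)
  qed (simp add: R_def)
  have R_root: "poly (map_poly of_rat R) y = y ^ 3 - 4 * of_int d * y - of_int d" for y :: complex
    by (simp add: R_def map_poly_pCons of_rat_minus of_rat_mult algebra_simps power3_eq_cube)
  have R_t: "poly (map_poly of_rat R) t1 = 0" "poly (map_poly of_rat R) t2 = 0" "poly (map_poly of_rat R) t3 = 0"
    unfolding R_root by (rule cubic_root[OF t] cubic_root[OF t'(1-3)] cubic_root[OF t'(4-6)])+
  have t1_image: "\<sigma> t1 = x (root_perm 4 x \<sigma> 1) * x (root_perm 4 x \<sigma> 2) + x (root_perm 4 x \<sigma> 3) * x (root_perm 4 x \<sigma> 4)"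
    if \<sigma>: "field_emb L \<sigma>" for \<sigma>
  proof -
    have "x (root_perm 4 x \<sigma> i) = \<sigma> (x i)" if "i \<in> {1..4}" for i by (rule perm_eq(2)[OF \<sigma> that])
    then show ?thesis
      unfolding t1_def x_simps[symmetric]
      using mem csubfield_mult[OF L] by (simp add: emb_add[OF L \<sigma>] emb_mult[OF L \<sigma>])
  qed
  \<comment> \<open>Conjugation along \<open>R\<close> carries \<open>t1\<close> to any root of
    \<open>R\<close>; the roots \<open>t2\<close> and \<open>t3\<close> then provide the two
    permutations from which a 3-cycle is extracted.\<close>
  have pairing: "\<exists>q\<in>H. q permutes {1..4} \<and> x (q 1) * x (q 2) + x (q 3) * x (q 4) = y"
    if y: "poly (map_poly of_rat R) y = 0" for y
  proof -
    obtain \<sigma> where \<sigma>: "field_emb L \<sigma>" "\<sigma> t1 = y"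
      by (rule conj[OF R_irr R_t(1) y mem_t1])
    have q: "root_perm 4 x \<sigma> \<in> H" using \<sigma>(1) by (simp add: H_def)
    show ?thesis
      by (rule bexI[OF _ q]) (use t1_image[OF \<sigma>(1)] \<sigma>(2) H_perm[OF q] in simp)
  qed
  obtain q2 where q2: "q2 \<in> H" "q2 permutes {1..4}" "x (q2 1) * x (q2 2) + x (q2 3) * x (q2 4) = t2"
    using pairing[OF R_t(2)] by blast
  obtain q3 where q3: "q3 \<in> H" "q3 permutes {1..4}" "x (q3 1) * x (q3 2) + x (q3 3) * x (q3 4) = t3"
    using pairing[OF R_t(3)] by blast
  have "{q2 1, q2 2} = {1, 3} \<or> {q2 1, q2 2} = {2, 4}"
    using pairing_value[OF q2(2), of x] t_ne unfolding q2(3) x_simps t1_def[symmetric] t2_def[symmetric] t3_def[symmetric] by metis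
  moreover have "{q3 1, q3 2} = {1, 4} \<or> {q3 1, q3 2} = {2, 3}"
    using pairing_value[OF q3(2), of x] t_ne unfolding q3(3) x_simps t1_def[symmetric] t2_def[symmetric] t3_def[symmetric] by metis
  ultimately obtain r i where three: "r \<in> H" "i \<in> {1..4}" "one_fixpoint r i"
    using one_fixpoint_from_pairings[OF H_perm H_comp q2(1) _ q3(1)] by metis
  \<comment> \<open>This is y^2 - D^2. It is irreducible because a rational root divided by
    \<open>d\<close> would be a square root of \<open>256 * d - 27\<close>; hence \<open>D\<close>
    and \<open>- D\<close> are conjugate.\<close>
  define Q :: "rat poly" where "Q = [:- ((of_int d)\<^sup>2 * (256 * of_int d - 27)), 0, 1:]"
  have Q_irr: "Factorial_Ring.irreducible Q"
  proof (rule irreducible_rat_small_degree)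
    fix r :: rat
    show "poly Q r \<noteq> 0"
    proof
      assume "poly Q r = 0"
      then have "r\<^sup>2 = (of_int d)\<^sup>2 * (256 * of_int d - 27)"
        by (simp add: Q_def power2_eq_square)
      then have "(r / of_int d)\<^sup>2 = 256 * of_int d - 27" using d by (simp add: power_divide)
      then show False using disc_not_rat_square by blast
    qed
  qed (simp add: Q_def)
  have Q_root: "poly (map_poly of_rat Q) y = y\<^sup>2 - D\<^sup>2" for y :: complex
    unfolding D2
    by (simp add: Q_def map_poly_pCons of_rat_minus of_rat_mult of_rat_diff of_rat_power power2_eq_square)
  obtain \<sigma> where \<sigma>: "field_emb L \<sigma>" "\<sigma> D = - D"
  proof (rule conj[OF Q_irr])
    show "poly (map_poly of_rat Q) D = 0" "poly (map_poly of_rat Q) (- D) = 0" by (simp_all add: Q_root)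
    show "D \<in> L" unfolding D_def by (rule emb_pairing_disc(2)[OF L field_emb_id in_L])
  qed
  define s where "s = root_perm 4 x \<sigma>"
  have s: "s \<in> H" unfolding s_def H_def using \<sigma>(1) by blast
  have xs: "x (s i) = \<sigma> (x i)" if "i \<in> {1..4}" for i unfolding s_def by (rule perm_eq(2)[OF \<sigma>(1) that])
  have "- D = pairing_disc (\<lambda>i. \<sigma> (x i))"
    using emb_pairing_disc(1)[OF L \<sigma>(1) in_L] \<sigma>(2) unfolding D_def by simp
  also have "\<dots> = pairing_disc (x \<circ> s)" using xs by (simp add: pairing_disc_def)
  also have "\<dots> = of_int (sign s) * D" unfolding D_def by (rule pairing_disc_permute[OF H_perm[OF s]])
  finally have odd: "\<not> evenperm s" using D_nz by (auto simp: sign_def)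
  have "\<exists>\<sigma>. field_emb L \<sigma> \<and> root_perm 4 x \<sigma> = q" if "q permutes {1..4}" for q
    using sym_group_4_criterion[OF H_perm H_comp H_trans three s odd that] unfolding H_def by blast
  then have "galois_group L \<cong> sym_group 4"
    by (rule galois_group_iso_sym_group[OF G S_def x_bij L_def])
  moreover have "galois_closure (rat_adjoin \<tau>) = L"
    using galois_closure_rat_adjoin[of p \<tau>, folded G_def, folded S_def, folded L_def] irr \<tau>
    unfolding G_int p_def by blast
  ultimately show ?thesis unfolding has_galois_group_def by simp
qed

section \<open>Irreducibility of the quartic\<close>

lemma irreducible_quartic:
  fixes d :: int
  assumes sqf: "squarefree d" and d: "d \<noteq> -2"
  shows "Factorial_Ring.irreducible (map_poly of_int (g_poly 1 d) :: rat poly)"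
proof -
  define p :: "rat poly" where "p = [:of_int d, 0, 0, 1, 1:]"
  have d0: "d \<noteq> 0" using sqf by auto
  have no_root: "poly p r \<noteq> 0" for r
  proof
    assume root: "poly p r = 0"
    have int: "poly.coeff p i \<in> \<int>" for i
      by (auto simp: p_def coeff_pCons split: nat.splits)
    obtain k where k: "r = of_int k"
      by (rule rational_root_int[OF root _ int]) (simp add: p_def)
    have "of_int (d + k ^ 3 * (k + 1)) = (0 :: rat)"
      using root by (simp add: p_def k algebra_simps power3_eq_cube)
    then have dk: "d + k ^ 3 * (k + 1) = 0" by (simp only: of_int_eq_0_iff)
    \<comment> \<open>Square-freeness forces k = 1 or k = -1, that is d = -2 or d = 0.\<close>
    then have "d = k ^ 2 * (- k * (k + 1))" by (simp add: algebra_simps power2_eq_square power3_eq_cube)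
    then have "k ^ 2 dvd d" by simp
    then have "is_unit k" using sqf by (simp add: squarefree_def)
    then have "k = 1 \<or> k = -1" by auto
    then show False using dk d d0 by auto
  qed
  have deg: "Polynomial.degree p = 4" by (simp add: p_def)
  then have nz: "p \<noteq> 0" by auto
  have "Factorial_Ring.irreducible p"
  proof (rule Factorial_Ring.irreducibleI)
    show "p \<noteq> 0" by (rule nz)
    show "\<not> is_unit p" using deg unfolding is_unit_iff_degree[OF nz] by simp
    fix a b assume ab: "p = a * b"
    have lin: "Polynomial.degree q \<noteq> 1" if "q dvd p" for q
    proof
      assume "Polynomial.degree q = 1"
      then obtain c e where q: "q = [:c, e:]" "e \<noteq> 0" by (metis degree1_coeffs)
      then have "poly q (- c / e) = 0" by simp
      then show False using that no_root by (metis dvdE mult_zero_left poly_mult)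
    qed
    have nz': "a \<noteq> 0" "b \<noteq> 0" using ab nz by auto
    have "Polynomial.degree a \<noteq> 1" "Polynomial.degree b \<noteq> 1" using lin ab by simp_all
    moreover have "Polynomial.degree a + Polynomial.degree b = 4"
      using nz' deg unfolding ab by (simp add: degree_mult_eq)
    moreover have "\<not> (Polynomial.degree a = 2 \<and> Polynomial.degree b = 2)"
    proof
      assume "Polynomial.degree a = 2 \<and> Polynomial.degree b = 2"
      then obtain a0 a1 a2 b0 b1 b2 where ab': "a = [:a0, a1, a2:]" "b = [:b0, b1, b2:]"
        by (metis degree2_coeffs)
      \<comment> \<open>For monic factors \<open>x\<^sup>2 + u x + f\<close> and \<open>x\<^sup>2 + v x + h\<close>, the sum \<open>f + h\<close> is a root of the
        resolvent cubic.\<close>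
      define u where "u = a1 * b2"
      define v where "v = b1 * a2"
      define f where "f = a0 * b2"
      define h where "h = b0 * a2"
      have c: "a0 * b0 = of_int d" "a0 * b1 + a1 * b0 = 0" "a0 * b2 + a1 * b1 + a2 * b0 = 0"
        "a1 * b2 + a2 * b1 = 1" "a2 * b2 = 1"
        using ab unfolding p_def ab' by (simp_all add: algebra_simps)
      have uv: "u + v = 1" using c(4) by (simp add: u_def v_def mult_ac)
      \<comment> \<open>As \<open>a2 * b2 = 1\<close>, the monic factors are \<open>b2 * a\<close>
        and \<open>a2 * b\<close>; this is where \<open>u\<close>, \<open>f\<close>,
        \<open>v\<close>, \<open>h\<close> come from.\<close>
      have "u * v = a1 * b1 * (a2 * b2)" by (simp add: u_def v_def)
      then have "u * v = a1 * b1" using c(5) by simp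
      then have s: "f + h = - (u * v)" using c(3) by (simp add: f_def h_def algebra_simps)
      have "f * v + h * u = (a0 * b1 + a1 * b0) * (a2 * b2)" by (simp add: f_def h_def u_def v_def algebra_simps)
      then have t: "f * v + h * u = 0" using c(2) by simp
      have "f * h = a0 * b0 * (a2 * b2)" by (simp add: f_def h_def)
      then have fh: "f * h = of_int d" using c(1,5) by simp
      \<comment> \<open>Elimination of \<open>u\<close> and \<open>v\<close>: the linear relations
        give v (f - h) = -h and u (f - h) = f. Multiplying them and using u v = -(f + h) leaves (f +
        h) (f - h)^2 = f h, where (f - h)^2 = (f + h)^2 - 4 f h.\<close>
      have u: "u = 1 - v" using uv by (simp add: algebra_simps)
      have "f * v + h * (1 - v) = 0" using t unfolding u .
      then have vh: "v * (f - h) = - h" by (simp add: algebra_simps eq_neg_iff_add_eq_0)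
      have "u * (f - h) = (f - h) - v * (f - h)" unfolding u by (simp add: algebra_simps)
      then have "u * (f - h) = f" unfolding vh by simp
      with vh have "(u * (f - h)) * (v * (f - h)) = - (f * h)" by simp
      then have "(f + h) * (f - h)\<^sup>2 = f * h" unfolding s by (simp add: power2_eq_square algebra_simps)
      then have "(f + h) ^ 3 - 4 * (f * h) * (f + h) - f * h = 0"
        by (simp add: power2_eq_square power3_eq_cube algebra_simps)
      then show False using resolvent_no_rat_root[OF d0] unfolding fh by blast
    qed
    ultimately have "Polynomial.degree a = 0 \<or> Polynomial.degree b = 0" by arith
    then show "is_unit a \<or> is_unit b" using nz' by (simp add: is_unit_iff_degree)
  qed
  then show ?thesis by (simp add: map_g_poly p_def)
qed

text \<open>At d = -2 the quartic has the root 1, and this is the only square-free \<open>d\<close>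
  that irreducibility excludes.\<close>

lemma monogeneity_hyps_1_iff:
  "monogeneity_hyps 1 d \<longleftrightarrow> squarefree d \<and> d \<noteq> -2 \<and>
     (\<forall>p::int. Factorial_Ring.prime p \<and> odd p \<longrightarrow> \<not> p\<^sup>2 dvd 256 * d - 27)"
proof -
  have "\<not> 4 dvd 256 * d - (27 :: int)" by presburger
  moreover have "\<not> Factorial_Ring.irreducible (map_poly of_int (g_poly 1 (-2)) :: rat poly)"
  proof
    assume irr: "Factorial_Ring.irreducible (map_poly of_int (g_poly 1 (-2)) :: rat poly)"
    have "map_poly of_int (g_poly 1 (-2)) = [:-1, 1:] * ([:2, 2, 2, 1:] :: rat poly)"
      by (simp add: map_g_poly)
    from Factorial_Ring.irreducibleD[OF irr this] show False
      by (auto simp: is_unit_iff_degree)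
  qed
  ultimately show ?thesis
    unfolding monogeneity_hyps_def using irreducible_quartic[of d] by auto
qed

section \<open>An Euler product bound\<close>

text \<open>A sieve on Euler's series for pi^2 / 6: multiples of a new prime \<open>q\<close> among
  the remaining \<open>n\<close> are \<open>q\<close> times the remaining \<open>n\<close>, so
  deleting them removes the fraction 1 / q^2 of the sum.\<close>

lemma inverse_squares_coprime_has_sum:
  fixes P :: "nat set"
  assumes "finite P" "\<And>p. p \<in> P \<Longrightarrow> Factorial_Ring.prime p"
  shows "((\<lambda>n. 1 / (real n)\<^sup>2) has_sum (pi\<^sup>2 / 6 * (\<Prod>p\<in>P. 1 - 1 / (real p)\<^sup>2)))
           {n. n > 0 \<and> (\<forall>p\<in>P. \<not> p dvd n)}"
  using assms
proof (induction P rule: finite_induct)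
  case empty
  have "((\<lambda>n. 1 / (real (Suc n))\<^sup>2) has_sum (pi\<^sup>2 / 6)) UNIV"
    using inverse_squares_sums by (intro norm_summable_imp_has_sum) (auto simp: sums_iff add.commute)
  then have "((\<lambda>n. 1 / (real n)\<^sup>2) has_sum (pi\<^sup>2 / 6)) (range Suc)"
    by (subst has_sum_reindex) (auto simp: o_def)
  moreover have "range Suc = {n. n > 0}" using gr0_conv_Suc by auto
  ultimately show ?case by simp
next
  case (insert q P)
  let ?A = "\<lambda>P. {n::nat. n > 0 \<and> (\<forall>p\<in>P. \<not> p dvd n)}"
  let ?f = "\<lambda>n. 1 / (real n)\<^sup>2" and ?s = "pi\<^sup>2 / 6 * (\<Prod>p\<in>P. 1 - 1 / (real p)\<^sup>2)"
  have q: "Factorial_Ring.prime q" using insert.prems by simp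
  have IH: "(?f has_sum ?s) (?A P)" using insert by simp
  have ndvd: "p dvd q * n \<longleftrightarrow> p dvd n" if "p \<in> P" for p n
    using that insert.hyps(2) insert.prems q by (metis insertCI prime_dvd_mult_iff primes_dvd_imp_eq dvd_mult)
  have "((\<lambda>n. 1 / (real q)\<^sup>2 * ?f n) has_sum (1 / (real q)\<^sup>2 * ?s)) (?A P)"
    by (rule has_sum_cmult_right[OF IH])
  then have "(?f has_sum (1 / (real q)\<^sup>2 * ?s)) ((\<lambda>n. q * n) ` ?A P)"
    using prime_gt_0_nat[OF q]
    by (subst has_sum_reindex) (auto simp: o_def inj_on_def power_mult_distrib)
  moreover have "(\<lambda>n. q * n) ` ?A P \<subseteq> ?A P"
    using ndvd prime_gt_0_nat[OF q] by auto
  ultimately have "(?f has_sum (?s - 1 / (real q)\<^sup>2 * ?s)) (?A P - (\<lambda>n. q * n) ` ?A P)"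
    by (intro has_sum_Diff IH)
  moreover have "?A P - (\<lambda>n. q * n) ` ?A P = ?A (insert q P)"
  proof (intro equalityI subsetI)
    fix n assume n: "n \<in> ?A P - (\<lambda>n. q * n) ` ?A P"
    have "\<not> q dvd n"
    proof
      assume "q dvd n"
      then obtain m where "n = q * m" by (elim dvdE)
      with n ndvd show False by auto
    qed
    with n show "n \<in> ?A (insert q P)" by auto
  qed auto
  moreover have "?s - 1 / (real q)\<^sup>2 * ?s = pi\<^sup>2 / 6 * (\<Prod>p\<in>insert q P. 1 - 1 / (real p)\<^sup>2)"
    using insert.hyps by (simp add: algebra_simps)
  ultimately show ?case by (simp only:)
qed

text \<open>The sieved series still contains the term 1 of n = 1. This bounds every finite product,
  with no infinite product involved.\<close>

lemma prod_primes_ge: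
  fixes P :: "nat set"
  assumes "finite P" "\<And>p. p \<in> P \<Longrightarrow> Factorial_Ring.prime p"
  shows "(\<Prod>p\<in>P. 1 - 1 / (real p)\<^sup>2) \<ge> 6 / pi\<^sup>2"
proof -
  let ?A = "{n::nat. n > 0 \<and> (\<forall>p\<in>P. \<not> p dvd n)}"
  have "((\<lambda>n. 1 / (real n)\<^sup>2) has_sum 1) {1}"
    using has_sum_finite[of "{1::nat}" "\<lambda>n. 1 / (real n)\<^sup>2"] by simp
  moreover have "1 \<in> ?A" using assms(2)[of "Suc 0"] prime_gt_1_nat[of "Suc 0"] by auto
  ultimately have "1 \<le> pi\<^sup>2 / 6 * (\<Prod>p\<in>P. 1 - 1 / (real p)\<^sup>2)"
    by (intro has_sum_mono_neutral[OF _ inverse_squares_coprime_has_sum[OF assms]]) auto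
  then show ?thesis by (simp add: field_simps)
qed

section \<open>Natural density\<close>

text \<open>Stronger than a density: the error is bounded uniformly over intervals in any position.
  Windows centred at 0 would not be carried to such windows by k -> m k + r.\<close>

definition has_bounded_discrepancy :: "int set \<Rightarrow> real \<Rightarrow> bool" where
  "has_bounded_discrepancy A \<delta> \<longleftrightarrow>
     (\<exists>C. \<forall>a b. a \<le> b \<longrightarrow> \<bar>real (card (A \<inter> {a..<b})) - \<delta> * of_int (b - a)\<bar> \<le> C)"

lemma has_bounded_discrepancyI:
  "(\<And>a b. a \<le> b \<Longrightarrow> \<bar>real (card (A \<inter> {a..<b})) - \<delta> * of_int (b - a)\<bar> \<le> C) \<Longrightarrow> has_bounded_discrepancy A \<delta>"
  unfolding has_bounded_discrepancy_def by blast

lemma has_bounded_discrepancyE: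
  assumes "has_bounded_discrepancy A \<delta>"
  obtains C where "\<And>a b. a \<le> b \<Longrightarrow> \<bar>real (card (A \<inter> {a..<b})) - \<delta> * of_int (b - a)\<bar> \<le> C"
  using assms unfolding has_bounded_discrepancy_def by blast

lemma has_bounded_discrepancy_UNIV: "has_bounded_discrepancy UNIV 1"
  by (rule has_bounded_discrepancyI[of _ _ 0]) simp

lemma has_bounded_discrepancy_empty: "has_bounded_discrepancy {} 0"
  by (rule has_bounded_discrepancyI[of _ _ 0]) simp

lemma has_bounded_discrepancy_diff:
  assumes "has_bounded_discrepancy A \<alpha>" "has_bounded_discrepancy B \<beta>" "B \<subseteq> A"
  shows "has_bounded_discrepancy (A - B) (\<alpha> - \<beta>)"
proof -
  obtain C where C: "\<And>a b. a \<le> b \<Longrightarrow> \<bar>real (card (A \<inter> {a..<b})) - \<alpha> * of_int (b - a)\<bar> \<le> C"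
    using has_bounded_discrepancyE[OF assms(1)] by blast
  obtain D where D: "\<And>a b. a \<le> b \<Longrightarrow> \<bar>real (card (B \<inter> {a..<b})) - \<beta> * of_int (b - a)\<bar> \<le> D"
    using has_bounded_discrepancyE[OF assms(2)] by blast
  show ?thesis
  proof (rule has_bounded_discrepancyI[of _ _ "C + D"])
    fix a b :: int assume ab: "a \<le> b"
    have "(A - B) \<inter> {a..<b} = A \<inter> {a..<b} - B \<inter> {a..<b}" by blast
    moreover have "B \<inter> {a..<b} \<subseteq> A \<inter> {a..<b}" using assms(3) by blast
    ultimately have "real (card ((A - B) \<inter> {a..<b})) = real (card (A \<inter> {a..<b})) - real (card (B \<inter> {a..<b}))"
      by (simp add: card_Diff_subset card_mono of_nat_diff)
    then show "\<bar>real (card ((A - B) \<inter> {a..<b})) - (\<alpha> - \<beta>) * of_int (b - a)\<bar> \<le> C + D"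
      using C[OF ab] D[OF ab] by (simp add: algebra_simps)
  qed
qed

lemma has_bounded_discrepancy_union:
  assumes "has_bounded_discrepancy A \<alpha>" "has_bounded_discrepancy B \<beta>" "A \<inter> B = {}"
  shows "has_bounded_discrepancy (A \<union> B) (\<alpha> + \<beta>)"
proof -
  obtain C where C: "\<And>a b. a \<le> b \<Longrightarrow> \<bar>real (card (A \<inter> {a..<b})) - \<alpha> * of_int (b - a)\<bar> \<le> C"
    using has_bounded_discrepancyE[OF assms(1)] by blast
  obtain D where D: "\<And>a b. a \<le> b \<Longrightarrow> \<bar>real (card (B \<inter> {a..<b})) - \<beta> * of_int (b - a)\<bar> \<le> D"
    using has_bounded_discrepancyE[OF assms(2)] by blast
  show ?thesis
  proof (rule has_bounded_discrepancyI[of _ _ "C + D"])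
    fix a b :: int assume ab: "a \<le> b"
    have "card ((A \<union> B) \<inter> {a..<b}) = card (A \<inter> {a..<b}) + card (B \<inter> {a..<b})"
      unfolding Int_Un_distrib2 by (rule card_Un_disjoint) (use assms(3) in auto)
    then show "\<bar>real (card ((A \<union> B) \<inter> {a..<b})) - (\<alpha> + \<beta>) * of_int (b - a)\<bar> \<le> C + D"
      using C[OF ab] D[OF ab] by (simp add: algebra_simps)
  qed
qed

lemma has_bounded_discrepancy_affine_image:
  assumes "has_bounded_discrepancy A \<delta>" and m: "m > 0"
  shows "has_bounded_discrepancy ((\<lambda>k. m * k + r) ` A) (\<delta> / of_int m)"
proof -
  obtain C where C: "\<And>a b. a \<le> b \<Longrightarrow> \<bar>real (card (A \<inter> {a..<b})) - \<delta> * of_int (b - a)\<bar> \<le> C"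
    using has_bounded_discrepancyE[OF assms(1)] by blast
  \<comment> \<open>The ceiling of (a - r) / m, the least \<open>k\<close> with
    \<open>a \<le> m * k + r\<close>. Rounding at the two ends of an interval costs the error 2
    |\<delta>|.\<close>
  define c where "c a = - ((r - a) div m)" for a
  have le_iff: "a \<le> m * k + r \<longleftrightarrow> c a \<le> k" for a k
  proof -
    define q where "q = (r - a) div m"
    have ra: "r - a = m * q + (r - a) mod m" unfolding q_def by simp
    have bounds: "0 \<le> (r - a) mod m" "(r - a) mod m < m" using m by simp_all
    have "0 \<le> m * (k + q)" if "0 \<le> k + q" using that m by simp
    moreover have "m * (k + q) \<le> m * (- 1)" if "\<not> 0 \<le> k + q"
      using that m by (intro mult_left_mono) auto
    ultimately have "a \<le> m * k + r \<longleftrightarrow> 0 \<le> k + q"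
      using ra bounds by (cases "0 \<le> k + q") (auto simp: algebra_simps)
    then show ?thesis unfolding c_def q_def by auto
  qed
  have approx: "\<bar>of_int (c a) - of_int (a - r) / (of_int m :: real)\<bar> \<le> 1" for a
  proof -
    have "m * c a = (a - r) + (r - a) mod m"
      unfolding c_def using mult_div_mod_eq[of m "r - a"] by (simp add: algebra_simps)
    then have "of_int m * of_int (c a) = (of_int (a - r) + of_int ((r - a) mod m) :: real)"
      by (metis of_int_add of_int_mult)
    then have "of_int (c a) - of_int (a - r) / (of_int m :: real) = of_int ((r - a) mod m) / of_int m"
      using m by (simp add: field_simps)
    moreover have "0 \<le> (r - a) mod m" "(r - a) mod m \<le> m"
      using m order_less_imp_le[OF pos_mod_bound[OF m, of "r - a"]] by (simp, blast)
    ultimately show ?thesis using m by (simp add: divide_le_eq)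
  qed
  show ?thesis
  proof (rule has_bounded_discrepancyI[of _ _ "C + 2 * \<bar>\<delta>\<bar>"])
    fix a b :: int assume ab: "a \<le> b"
    have "(\<lambda>k. m * k + r) ` A \<inter> {a..<b} = (\<lambda>k. m * k + r) ` (A \<inter> {c a..<c b})"
      using le_iff[of a] le_iff[of b] by (auto simp: not_le[symmetric])
    moreover have "inj_on (\<lambda>k. m * k + r) (A \<inter> {c a..<c b})" using m by (auto simp: inj_on_def)
    ultimately have card: "card ((\<lambda>k. m * k + r) ` A \<inter> {a..<b}) = card (A \<inter> {c a..<c b})"
      by (simp add: card_image)
    have "c a \<le> c b" using ab m unfolding c_def by (simp add: zdiv_mono1)
    from C[OF this] have 1: "\<bar>real (card (A \<inter> {c a..<c b})) - \<delta> * of_int (c b - c a)\<bar> \<le> C" .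
    have "\<bar>of_int (c b - c a) - of_int (b - a) / (of_int m :: real)\<bar> \<le> 2"
      using approx[of a] approx[of b] by (simp add: diff_divide_distrib)
    then have "\<bar>\<delta>\<bar> * \<bar>of_int (c b - c a) - of_int (b - a) / (of_int m :: real)\<bar> \<le> \<bar>\<delta>\<bar> * 2"
      by (rule mult_left_mono) simp
    then have "\<bar>\<delta> * of_int (c b - c a) - \<delta> / of_int m * of_int (b - a)\<bar> \<le> 2 * \<bar>\<delta>\<bar>"
      unfolding abs_mult[symmetric] by (simp add: algebra_simps diff_divide_distrib)
    with 1 show "\<bar>real (card ((\<lambda>k. m * k + r) ` A \<inter> {a..<b})) - \<delta> / of_int m * of_int (b - a)\<bar> \<le> C + 2 * \<bar>\<delta>\<bar>"
      unfolding card by linarith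
  qed
qed

text \<open>A periodic set is a finite disjoint union of residue classes, each an affine image of
  all integers.\<close>

lemma has_bounded_discrepancy_periodic:
  assumes M: "M > 0" and per: "\<And>k. k \<in> A \<longleftrightarrow> k mod M \<in> A"
  shows "\<exists>\<delta>. has_bounded_discrepancy A \<delta>"
proof -
  have "\<exists>\<delta>. has_bounded_discrepancy {k. k mod M \<in> R} \<delta>" if "finite R" "R \<subseteq> {0..<M}" for R
    using that
  proof (induction R rule: finite_induct)
    case empty
    then show ?case using has_bounded_discrepancy_empty by auto
  next
    case (insert r R)
    then obtain \<delta> where \<delta>: "has_bounded_discrepancy {k. k mod M \<in> R} \<delta>" by auto
    have r: "r mod M = r" using insert.prems by simp
    have "{k. k mod M = r} = (\<lambda>k. M * k + r) ` UNIV"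
    proof (intro equalityI subsetI)
      fix k assume "k \<in> {k. k mod M = r}"
      then have "k = M * (k div M) + r" by auto
      then show "k \<in> range (\<lambda>k. M * k + r)" by blast
    qed (auto simp: r)
    then have "has_bounded_discrepancy {k. k mod M = r} (1 / of_int M)"
      using has_bounded_discrepancy_affine_image[OF has_bounded_discrepancy_UNIV M, of r] by simp
    moreover have "{k. k mod M \<in> insert r R} = {k. k mod M = r} \<union> {k. k mod M \<in> R}" by auto
    moreover have "{k. k mod M = r} \<inter> {k. k mod M \<in> R} = {}" using insert.hyps by auto
    ultimately show ?case using has_bounded_discrepancy_union[OF _ \<delta>] by metis
  qed
  from this[of "A \<inter> {0..<M}"] have "\<exists>\<delta>. has_bounded_discrepancy {k. k mod M \<in> A \<inter> {0..<M}} \<delta>" by simp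
  moreover have "{k. k mod M \<in> A \<inter> {0..<M}} = A" using per M by auto
  ultimately show ?thesis by simp
qed

text \<open>The induction on \<open>P\<close> replaces the Chinese remainder theorem: the \<open>d\<close> with \<open>q\<^sup>2\<close> dividing
  \<open>a d + b\<close> are the \<open>q\<^sup>2 k + r\<close>, and for these the remaining conditions are those on \<open>a k + b'\<close>
  for another \<open>b'\<close>.\<close>

lemma has_bounded_discrepancy_squarefree_values:
  fixes P :: "nat set" and a b :: int
  assumes "finite P" "\<And>p. p \<in> P \<Longrightarrow> Factorial_Ring.prime p \<and> \<not> int p dvd a"
  shows "has_bounded_discrepancy {d. \<forall>p\<in>P. \<not> (int p)\<^sup>2 dvd a * d + b} (\<Prod>p\<in>P. 1 - 1 / (real p)\<^sup>2)"
  using assms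
proof (induction P arbitrary: b rule: finite_induct)
  case empty
  then show ?case using has_bounded_discrepancy_UNIV by simp
next
  case (insert q P)
  let ?S = "\<lambda>P b. {d. \<forall>p\<in>P. \<not> (int p)\<^sup>2 dvd a * d + b}"
  let ?\<delta> = "\<Prod>p\<in>P. 1 - 1 / (real p)\<^sup>2"
  have IH: "has_bounded_discrepancy (?S P b) ?\<delta>" for b using insert by simp
  have q: "Factorial_Ring.prime q" "\<not> int q dvd a" using insert.prems by auto
  have "Rings.coprime (int q) a" using q by (simp add: prime_imp_coprime)
  then have cop: "Rings.coprime a ((int q)\<^sup>2)" by (simp add: coprime_commute)
  then obtain i where "[a * i = 1] (mod (int q)\<^sup>2)" using cong_solve_coprime_int by blast
  then have "[a * i * (- b) + b = 1 * (- b) + b] (mod (int q)\<^sup>2)"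
    by (intro cong_add cong_mult cong_refl)
  then have "(int q)\<^sup>2 dvd a * (i * (- b)) + b" by (simp add: cong_0_iff mult_ac)
  then obtain r b' where r: "a * r + b = (int q)\<^sup>2 * b'" by (metis dvdE)
  have "?S P b - ?S (insert q P) b = (\<lambda>k. (int q)\<^sup>2 * k + r) ` ?S P b'"
  proof -
    have val: "a * ((int q)\<^sup>2 * k + r) + b = (int q)\<^sup>2 * (a * k + b')" for k
      using r by (simp add: algebra_simps)
    have dvd_iff: "(int p)\<^sup>2 dvd (int q)\<^sup>2 * x \<longleftrightarrow> (int p)\<^sup>2 dvd x" if "p \<in> P" for p x
    proof (rule coprime_dvd_mult_right_iff)
      have "Rings.coprime p q" using that insert q by (metis insertCI primes_coprime)
      then show "Rings.coprime ((int p)\<^sup>2) ((int q)\<^sup>2)" by simp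
    qed
    have ex: "\<exists>k. d = (int q)\<^sup>2 * k + r" if "(int q)\<^sup>2 dvd a * d + b" for d
    proof -
      have "(int q)\<^sup>2 dvd (a * d + b) - (a * r + b)" using that r by (metis dvd_diff dvd_triv_left)
      then have "(int q)\<^sup>2 dvd a * (d - r)" by (simp add: algebra_simps)
      then have "(int q)\<^sup>2 dvd d - r" using cop by (simp add: coprime_dvd_mult_right_iff coprime_commute)
      then obtain k where "d - r = (int q)\<^sup>2 * k" by (elim dvdE)
      then show ?thesis by (intro exI[of _ k]) simp
    qed
    show ?thesis
    proof (intro equalityI subsetI)
      fix d assume d: "d \<in> ?S P b - ?S (insert q P) b"
      then have "(int q)\<^sup>2 dvd a * d + b" by auto
      then obtain k where k: "d = (int q)\<^sup>2 * k + r" using ex by blast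
      then have "k \<in> ?S P b'" using d dvd_iff val[of k] by auto
      then show "d \<in> (\<lambda>k. (int q)\<^sup>2 * k + r) ` ?S P b'" using k by blast
    next
      fix d assume "d \<in> (\<lambda>k. (int q)\<^sup>2 * k + r) ` ?S P b'"
      then show "d \<in> ?S P b - ?S (insert q P) b" using dvd_iff val by auto
    qed
  qed
  \<comment> \<open>The induction hypothesis covers every offset, so the set for \<open>b'\<close>
    has the same \<open>?\<delta>\<close>, and removing its image leaves the fraction 1 - 1 /
    q^2.\<close>
  moreover have "has_bounded_discrepancy ((\<lambda>k. (int q)\<^sup>2 * k + r) ` ?S P b') (?\<delta> / of_int ((int q)\<^sup>2))"
    by (rule has_bounded_discrepancy_affine_image[OF IH]) (use prime_gt_0_nat[OF q(1)] in simp)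
  ultimately have "has_bounded_discrepancy (?S P b - (?S P b - ?S (insert q P) b)) (?\<delta> - ?\<delta> / of_int ((int q)\<^sup>2))"
    by (intro has_bounded_discrepancy_diff IH) auto
  moreover have "?S P b - (?S P b - ?S (insert q P) b) = ?S (insert q P) b" by auto
  moreover have "?\<delta> - ?\<delta> / of_int ((int q)\<^sup>2) = (\<Prod>p\<in>insert q P. 1 - 1 / (real p)\<^sup>2)"
    using insert.hyps by (simp add: algebra_simps)
  ultimately show ?case by (simp only:)
qed

section \<open>Counting functions and passage to natural density\<close>

definition count_upto :: "int set \<Rightarrow> nat \<Rightarrow> nat" where
  "count_upto A N = card {d \<in> A. \<bar>d\<bar> \<le> int N}"

lemma finite_abs_le: "finite {d \<in> A. \<bar>d\<bar> \<le> int N}"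
  by (rule finite_subset[of _ "{- int N..int N}"]) auto

lemma count_upto_UNIV: "card {d::int. \<bar>d\<bar> \<le> int N} = 2 * N + 1"
proof -
  have "{d::int. \<bar>d\<bar> \<le> int N} = {- int N..int N}" by auto
  then show ?thesis by simp
qed

lemma has_natural_density_iff:
  "has_natural_density A \<delta> \<longleftrightarrow> (\<lambda>N. real (count_upto A N) / (2 * real N + 1)) \<longlonglongrightarrow> \<delta>"
  unfolding has_natural_density_def count_upto_def count_upto_UNIV by (simp add: add.commute)

lemma inverse_odd_tendsto_0: "(\<lambda>N. C / (2 * real N + 1)) \<longlonglongrightarrow> 0"
proof -
  have "strict_mono (\<lambda>N::nat. 2 * N)" by (auto simp: strict_mono_def)
  from LIMSEQ_subseq_LIMSEQ[OF LIMSEQ_inverse_real_of_nat this]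
  have "(\<lambda>N. inverse (real (Suc (2 * N)))) \<longlonglongrightarrow> 0" by (simp add: o_def)
  from tendsto_mult_right_zero[OF this, of C] show ?thesis
    by (simp add: divide_inverse add.commute)
qed

lemma bounded_discrepancy_natural_density:
  assumes "has_bounded_discrepancy A \<delta>"
  shows "has_natural_density A \<delta>"
proof -
  obtain C where C: "\<And>a b. a \<le> b \<Longrightarrow> \<bar>real (card (A \<inter> {a..<b})) - \<delta> * of_int (b - a)\<bar> \<le> C"
    using has_bounded_discrepancyE[OF assms] by blast
  have "\<bar>real (count_upto A N) / (2 * real N + 1) - \<delta>\<bar> \<le> C / (2 * real N + 1)" for N
  proof -
    have "{d \<in> A. \<bar>d\<bar> \<le> int N} = A \<inter> {- int N..<int N + 1}" by auto
    then have "\<bar>real (count_upto A N) - \<delta> * (2 * real N + 1)\<bar> \<le> C"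
      using C[of "- int N" "int N + 1"] by (simp add: count_upto_def algebra_simps)
    then have "\<bar>real (count_upto A N) - \<delta> * (2 * real N + 1)\<bar> / (2 * real N + 1) \<le> C / (2 * real N + 1)"
      by (intro divide_right_mono) auto
    moreover have "real (count_upto A N) / (2 * real N + 1) - \<delta> =
        (real (count_upto A N) - \<delta> * (2 * real N + 1)) / (2 * real N + 1)"
      by (simp add: field_simps)
    ultimately show ?thesis by (simp add: abs_divide)
  qed
  then have "(\<lambda>N. real (count_upto A N) / (2 * real N + 1) - \<delta>) \<longlonglongrightarrow> 0"
    by (intro Lim_null_comparison[OF always_eventually inverse_odd_tendsto_0[of C]]) auto
  then show ?thesis unfolding has_natural_density_iff by (simp add: LIM_zero_iff)
qed

text \<open>Inclusion-exclusion in a window of 2 N + 1 integers.\<close>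

lemma natural_density_inter_ge:
  assumes "has_natural_density A \<alpha>" "has_natural_density B \<beta>" "has_natural_density (A \<inter> B) \<gamma>"
  shows "\<alpha> + \<beta> - 1 \<le> \<gamma>"
proof (rule LIMSEQ_le)
  let ?f = "\<lambda>A N. real (count_upto A N) / (2 * real N + 1)"
  show "(\<lambda>N. ?f A N + ?f B N - 1) \<longlonglongrightarrow> \<alpha> + \<beta> - 1" "?f (A \<inter> B) \<longlonglongrightarrow> \<gamma>"
    using assms unfolding has_natural_density_iff by (auto intro!: tendsto_intros)
  have "?f A N + ?f B N - 1 \<le> ?f (A \<inter> B) N" for N
  proof -
    let ?I = "{d::int. \<bar>d\<bar> \<le> int N}"
    let ?A = "{d \<in> A. \<bar>d\<bar> \<le> int N}" and ?B = "{d \<in> B. \<bar>d\<bar> \<le> int N}"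
    have "card ?A + card ?B = card (?A \<union> ?B) + card (?A \<inter> ?B)"
      by (rule card_Un_Int) (rule finite_abs_le)+
    moreover have "card (?A \<union> ?B) \<le> card ?I"
      by (rule card_mono) (use finite_abs_le[of UNIV] in auto)
    moreover have "?A \<inter> ?B = {d \<in> A \<inter> B. \<bar>d\<bar> \<le> int N}" by auto
    ultimately have "count_upto A N + count_upto B N \<le> 2 * N + 1 + count_upto (A \<inter> B) N"
      unfolding count_upto_def count_upto_UNIV by simp
    then have "real (count_upto A N) + real (count_upto B N) - (2 * real N + 1) \<le> real (count_upto (A \<inter> B) N)"
      by linarith
    then have "(real (count_upto A N) + real (count_upto B N) - (2 * real N + 1)) / (2 * real N + 1)
        \<le> real (count_upto (A \<inter> B) N) / (2 * real N + 1)"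
      by (rule divide_right_mono) simp
    then show ?thesis by (simp add: add_divide_distrib diff_divide_distrib)
  qed
  then show "\<exists>N. \<forall>n\<ge>N. ?f A n + ?f B n - 1 \<le> ?f (A \<inter> B) n" by blast
qed

section \<open>Sieving by squares of primes\<close>

text \<open>The second condition is imposed at odd primes only, matching the hypotheses; at 2 it
  would hold automatically because \<open>256 * d - 27\<close> is odd.\<close>

definition sieved :: "nat \<Rightarrow> int set" where
  "sieved z = {d. \<forall>p::nat. Factorial_Ring.prime p \<and> p \<le> z \<longrightarrow>
     \<not> (int p)\<^sup>2 dvd d \<and> (odd p \<longrightarrow> \<not> (int p)\<^sup>2 dvd 256 * d - 27)}"

lemma sieved_density_exists: "\<exists>\<delta>. has_natural_density (sieved z) \<delta>"
proof -
  \<comment> \<open>Any positive common multiple of the p^2 is a period; this one is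
    convenient.\<close>
  define M where "M = (\<Prod>k\<in>{1..z}. (int k)\<^sup>2)"
  have M: "M > 0" unfolding M_def by (rule prod_pos) simp
  have dvdM: "(int p)\<^sup>2 dvd M" if "Factorial_Ring.prime p" "p \<le> z" for p
    unfolding M_def using that prime_gt_0_nat[of p] by (intro dvd_prodI) auto
  have "(int p)\<^sup>2 dvd d \<longleftrightarrow> (int p)\<^sup>2 dvd d mod M" "(int p)\<^sup>2 dvd 256 * d - 27 \<longleftrightarrow> (int p)\<^sup>2 dvd 256 * (d mod M) - 27"
    if p: "Factorial_Ring.prime p" "p \<le> z" for p d
  proof -
    have "(int p)\<^sup>2 dvd d - d mod M" using dvdM[OF p] by (rule dvd_trans) (simp add: minus_mod_eq_mult_div)
    then have *: "(int p)\<^sup>2 dvd 256 * (d - d mod M)" by (rule dvd_mult)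
    show "(int p)\<^sup>2 dvd d \<longleftrightarrow> (int p)\<^sup>2 dvd d mod M"
      using dvd_mod_iff[OF dvdM[OF p], of d] by simp
    have "256 * d - 27 = 256 * (d - d mod M) + (256 * (d mod M) - 27)" by simp
    then show "(int p)\<^sup>2 dvd 256 * d - 27 \<longleftrightarrow> (int p)\<^sup>2 dvd 256 * (d mod M) - 27"
      using dvd_add_right_iff[OF *] by metis
  qed
  then have "d \<in> sieved z \<longleftrightarrow> d mod M \<in> sieved z" for d
    unfolding sieved_def mem_Collect_eq by metis
  then show ?thesis
    using has_bounded_discrepancy_periodic[OF M] bounded_discrepancy_natural_density by blast
qed

lemma sieved_density_ge:
  assumes z: "z \<ge> 2" and \<delta>: "has_natural_density (sieved z) \<delta>"
  shows "\<delta> \<ge> (14 - pi\<^sup>2) / pi\<^sup>2"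
proof -
  define P where "P = {p. Factorial_Ring.prime p \<and> p \<le> z}"
  define w where "w Q = (\<Prod>p\<in>Q. 1 - 1 / (real p)\<^sup>2)" for Q :: "nat set"
  have P: "finite P" "2 \<in> P" using z two_is_prime_nat by (auto simp: P_def)
  define U where "U = {d. \<forall>p\<in>P. \<not> (int p)\<^sup>2 dvd 1 * d + 0}"
  \<comment> \<open>The sieve lemma asks for primes not dividing the coefficient 256. Omitting 2
    also makes the product for \<open>V\<close> larger by the factor 4 / 3.\<close>
  define V where "V = {d. \<forall>p\<in>P - {2}. \<not> (int p)\<^sup>2 dvd 256 * d + -27}"
  have U: "has_natural_density U (w P)"
    unfolding U_def w_def
    by (intro bounded_discrepancy_natural_density has_bounded_discrepancy_squarefree_values P)
       (auto simp: P_def)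
  have V: "has_natural_density V (w (P - {2}))"
    unfolding V_def w_def
  proof (intro bounded_discrepancy_natural_density has_bounded_discrepancy_squarefree_values)
    fix p assume p: "p \<in> P - {2}"
    have "\<not> p dvd 256"
    proof
      assume "p dvd 256"
      also have "256 = (2 :: nat) ^ 8" by simp
      finally have "p dvd 2" using p prime_dvd_power_nat[of p 2 8] by (simp add: P_def)
      then show False using p primes_dvd_imp_eq[of p 2] two_is_prime_nat by (simp add: P_def)
    qed
    then have "\<not> int p dvd int 256" unfolding int_dvd_int_iff .
    then show "Factorial_Ring.prime p \<and> \<not> int p dvd 256" using p by (simp add: P_def)
  qed (use P in simp)
  have odd_iff: "odd p \<longleftrightarrow> p \<noteq> 2" if "p \<in> P" for p
    using that prime_odd_nat[of p] prime_ge_2_nat[of p] by (cases "p = 2") (auto simp: P_def)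
  have "sieved z = U \<inter> V"
    using odd_iff unfolding sieved_def U_def V_def P_def by auto
  then have "w P + w (P - {2}) - 1 \<le> \<delta>" using natural_density_inter_ge[OF U V] \<delta> by simp
  moreover have wP: "w P \<ge> 6 / pi\<^sup>2"
    unfolding w_def by (rule prod_primes_ge) (use P in \<open>auto simp: P_def\<close>)
  moreover have "w P = (3 / 4) * w (P - {2})"
    unfolding w_def by (subst prod.remove[OF P]) simp
  ultimately have "8 / pi\<^sup>2 + 6 / pi\<^sup>2 - 1 \<le> \<delta>" by simp
  then show ?thesis by (simp add: field_simps)
qed

text \<open>Solutions lie in one residue class modulo \<open>m\<close>, so \<open>d div m\<close>
  identifies them. The quotients range over an interval with at most 2 N / m + 2 integers.\<close>

lemma card_dvd_linear_le:
  assumes m: "m > 0" and cop: "Rings.coprime a m"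
  shows "real (card {d::int. \<bar>d\<bar> \<le> int N \<and> m dvd a * d + b}) \<le> (2 * real N + 1) / of_int m + 2"
proof -
  let ?S = "{d::int. \<bar>d\<bar> \<le> int N \<and> m dvd a * d + b}"
  have "inj_on (\<lambda>d. d div m) ?S"
  proof (rule inj_onI)
    fix d e assume d: "d \<in> ?S" and e: "e \<in> ?S" and eq: "d div m = e div m"
    have "m dvd (a * d + b) - (a * e + b)" using d e by (intro dvd_diff) auto
    then have "m dvd a * (d - e)" by (simp add: algebra_simps)
    then have "m dvd d - e" using cop by (simp add: coprime_dvd_mult_right_iff coprime_commute)
    then have "d mod m = e mod m" by (simp add: mod_eq_dvd_iff)
    with eq show "d = e" by (metis mult_div_mod_eq)
  qed
  moreover have "(\<lambda>d. d div m) ` ?S \<subseteq> {(- int N) div m..int N div m}"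
    using m by (auto intro!: zdiv_mono1)
  ultimately have "card ?S \<le> card {(- int N) div m..int N div m}"
    by (intro card_inj_on_le) auto
  then have "card ?S \<le> nat (int N div m + 1 - (- int N) div m)" by simp
  moreover have "(- int N) div m \<le> int N div m" using m by (intro zdiv_mono1) auto
  ultimately have "real (card ?S) \<le> of_int (int N div m) + 1 - of_int ((- int N) div m)" by linarith
  moreover have "of_int (int N div m) \<le> (real N / of_int m :: real)"
    using real_of_int_div4[of "int N" m] by simp
  moreover have "- (real N / of_int m) - of_int ((- int N) div m) \<le> (1 :: real)"
    using real_of_int_div3[of "- int N" m] by simp
  ultimately have "real (card ?S) \<le> 2 * (real N / of_int m) + 2" by linarith
  moreover have "2 * real N / of_int m \<le> (2 * real N + 1) / of_int m"
    using m by (intro divide_right_mono) auto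
  ultimately show ?thesis by simp
qed

text \<open>Telescoping, from 1 / (n + 1)^2 \<le> 1 / n - 1 / (n + 1).\<close>

lemma sum_inverse_squares_tail:
  assumes "z \<ge> 1" "z \<le> K"
  shows "(\<Sum>k\<in>{z<..K}. 1 / (real k)\<^sup>2) \<le> 1 / real z - 1 / real K"
  using assms(2)
proof (induction K rule: dec_induct)
  case (step n)
  have n: "real n > 0" using assms(1) step by simp
  have "{z<..Suc n} = insert (Suc n) {z<..n}" using step by auto
  then have "(\<Sum>k\<in>{z<..Suc n}. 1 / (real k)\<^sup>2) = 1 / (real (Suc n))\<^sup>2 + (\<Sum>k\<in>{z<..n}. 1 / (real k)\<^sup>2)" by simp
  also have "\<dots> \<le> 1 / (real (Suc n))\<^sup>2 + (1 / real z - 1 / real n)" using step.IH by simp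
  also have "1 / (real (Suc n))\<^sup>2 \<le> 1 / (real n * real (Suc n))"
    using n by (intro divide_left_mono) (auto simp: power2_eq_square)
  also have "1 / (real n * real (Suc n)) = 1 / real n - 1 / real (Suc n)"
    using n by (simp add: field_simps)
  finally show ?case by simp
qed simp

lemma sieved_superset: "{d. monogeneity_hyps 1 d} \<subseteq> sieved z"
proof
  fix d assume "d \<in> {d. monogeneity_hyps 1 d}"
  then have d: "squarefree d" "\<And>p::int. Factorial_Ring.prime p \<Longrightarrow> odd p \<Longrightarrow> \<not> p\<^sup>2 dvd 256 * d - 27"
    by (auto simp: monogeneity_hyps_1_iff)
  show "d \<in> sieved z"
    unfolding sieved_def
  proof (intro CollectI allI impI conjI)
    fix p :: nat assume p: "Factorial_Ring.prime p \<and> p \<le> z"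
    show "\<not> (int p)\<^sup>2 dvd d"
      using d(1) p unfolding squarefree_def by (auto dest!: spec[of _ "int p"])
    show "\<not> (int p)\<^sup>2 dvd 256 * d - 27" if "odd p" using d(2)[of "int p"] p that by simp
  qed
qed

text \<open>Apart from -2, an integer that passes the sieve and fails the hypotheses has a witness
  prime beyond \<open>z\<close>. Its square divides a nonzero value of size at most 283 N, which
  bounds it by \<open>K\<close>. Oddness of \<open>k\<close> is recorded to keep k^2 coprime to
  256.\<close>

lemma sieved_diff_subset:
  assumes z: "z \<ge> 2" and N: "N \<ge> 1" and K: "\<And>k::nat. k\<^sup>2 \<le> 283 * N \<Longrightarrow> k \<le> K"
    and d: "d \<in> sieved z" "\<bar>d\<bar> \<le> int N" "\<not> monogeneity_hyps 1 d"
  shows "d = -2 \<or> (\<exists>k\<in>{z<..K}. (int k)\<^sup>2 dvd 1 * d + 0 \<or> odd k \<and> (int k)\<^sup>2 dvd 256 * d + -27)"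
proof -
  \<comment> \<open>The prime 2 is sieved because \<open>z \<ge> 2\<close>; this rules out d = 0,
    which every square divides.\<close>
  have not4: "\<not> (int 2)\<^sup>2 dvd d" using d(1) z two_is_prime_nat unfolding sieved_def by blast
  then have d0: "d \<noteq> 0" by auto
  have le: "k \<le> K" if "(int k)\<^sup>2 dvd y" "y \<noteq> 0" "\<bar>y\<bar> \<le> 283 * int N" for k y
  proof -
    have "(int k)\<^sup>2 \<le> \<bar>y\<bar>" using dvd_imp_le_int[OF that(2,1)] by simp
    then have "int (k\<^sup>2) \<le> int (283 * N)" using that(3) by simp
    then show ?thesis by (intro K) (simp only: of_nat_le_iff)
  qed
  have nat: "\<exists>k::nat. p = int k \<and> Factorial_Ring.prime k" if "Factorial_Ring.prime p" for p :: int
    using that by (metis prime_int_nat_transfer prime_ge_0_int nat_0_le int_nat_eq)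
  have sv: "\<not> (int k)\<^sup>2 dvd d \<and> (odd k \<longrightarrow> \<not> (int k)\<^sup>2 dvd 256 * d - 27)"
    if "Factorial_Ring.prime k" "k \<le> z" for k
    using d(1) that by (simp add: sieved_def)
  consider "d = -2" | "\<not> squarefree d" | p :: int where "Factorial_Ring.prime p" "odd p" "p\<^sup>2 dvd 256 * d - 27"
    using d(3) unfolding monogeneity_hyps_1_iff by blast
  then show ?thesis
  proof cases
    case 2
    then obtain p where p: "Factorial_Ring.prime p" "p\<^sup>2 dvd d"
      unfolding squarefree_factorial_semiring[OF d0] by blast
    obtain k where pk: "p = int k" "Factorial_Ring.prime k" using nat[OF p(1)] by blast
    then have k: "Factorial_Ring.prime k" "(int k)\<^sup>2 dvd d" using p(2) by simp_all
    then have "z < k" using sv[OF k(1)] by (meson not_le)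
    moreover have "k \<le> K" by (rule le[OF k(2) d0]) (use d(2) in simp)
    ultimately show ?thesis using k(2) by auto
  next
    case 3
    obtain k where pk: "p = int k" "Factorial_Ring.prime k" using nat[OF 3(1)] by blast
    then have k: "Factorial_Ring.prime k" "odd k" "(int k)\<^sup>2 dvd 256 * d - 27" using 3 by simp_all
    then have "z < k" using sv[OF k(1)] by (meson not_le)
    moreover have "256 * d - 27 \<noteq> 0" by presburger
    then have "k \<le> K" by (rule le[OF k(3)]) (use d(2) N in simp)
    ultimately show ?thesis using k(2,3) by auto
  qed simp
qed

text \<open>Each \<open>k\<close> contributes (2 N + 1) / k^2 + 2 for either family
  \<open>S\<close>, \<open>T\<close>. The main terms sum to the multiple of 1 / z, the constants to
  4 K with K at most sqrt(283 N), and the last 1 is for -2.\<close>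

lemma count_sieved_diff_le:
  assumes z: "z \<ge> 2" and N: "N \<ge> 1"
  shows "real (count_upto (sieved z) N) - real (count_upto {d. monogeneity_hyps 1 d} N)
    \<le> 2 * (2 * real N + 1) / real z + 4 * sqrt (283 * real N) + 1"
proof -
  define K where "K = nat \<lfloor>sqrt (283 * real N)\<rfloor>"
  have K: "k \<le> K" if "k\<^sup>2 \<le> 283 * N" for k :: nat
  proof -
    have "real (k\<^sup>2) \<le> real (283 * N)" using that by (simp only: of_nat_le_iff)
    then have "real k \<le> sqrt (283 * real N)" by (intro real_le_rsqrt) simp
    then show ?thesis unfolding K_def by (rule le_nat_floor)
  qed
  have K': "real K \<le> sqrt (283 * real N)" unfolding K_def by simp
  let ?I = "\<lambda>A. {d \<in> A. \<bar>d\<bar> \<le> int N}"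
  let ?A = "sieved z" and ?B = "{d. monogeneity_hyps 1 d}"
  define S where "S k = {d::int. \<bar>d\<bar> \<le> int N \<and> (int k)\<^sup>2 dvd 1 * d + 0}" for k
  define T where "T k = (if odd k then {d::int. \<bar>d\<bar> \<le> int N \<and> (int k)\<^sup>2 dvd 256 * d + -27} else {})" for k
  have fin: "finite (S k)" "finite (T k)" for k
    unfolding S_def T_def by (auto intro: finite_subset[OF _ finite_abs_le[of UNIV N]])
  have "?I ?A - ?I ?B \<subseteq> {-2} \<union> (\<Union>k\<in>{z<..K}. S k \<union> T k)"
  proof
    fix d assume "d \<in> ?I ?A - ?I ?B"
    then have d: "d \<in> sieved z" "\<bar>d\<bar> \<le> int N" "\<not> monogeneity_hyps 1 d" by auto
    from sieved_diff_subset[OF z N K d] d(2) show "d \<in> {-2} \<union> (\<Union>k\<in>{z<..K}. S k \<union> T k)"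
      unfolding S_def T_def by auto
  qed
  then have "card (?I ?A - ?I ?B) \<le> card ({-2} \<union> (\<Union>k\<in>{z<..K}. S k \<union> T k))"
    using fin by (intro card_mono) auto
  also have "\<dots> \<le> 1 + card (\<Union>k\<in>{z<..K}. S k \<union> T k)" using card_Un_le[of "{-2::int}"] by simp
  also have "card (\<Union>k\<in>{z<..K}. S k \<union> T k) \<le> (\<Sum>k\<in>{z<..K}. card (S k \<union> T k))"
    by (rule card_UN_le) simp
  also have "\<dots> \<le> (\<Sum>k\<in>{z<..K}. card (S k) + card (T k))" by (intro sum_mono card_Un_le)
  finally have "real (card (?I ?A - ?I ?B)) \<le> 1 + (\<Sum>k\<in>{z<..K}. real (card (S k)) + real (card (T k)))"
    by (simp flip: of_nat_add of_nat_sum of_nat_Suc)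
  also have "(\<Sum>k\<in>{z<..K}. real (card (S k)) + real (card (T k)))
      \<le> (\<Sum>k\<in>{z<..K}. 2 * (2 * real N + 1) * (1 / (real k)\<^sup>2) + 4)"
  proof (rule sum_mono)
    fix k assume k: "k \<in> {z<..K}"
    then have pos: "(int k)\<^sup>2 > 0" by simp
    have "real (card (S k)) \<le> (2 * real N + 1) / of_int ((int k)\<^sup>2) + 2"
      unfolding S_def by (rule card_dvd_linear_le[OF pos]) simp
    moreover have "real (card (T k)) \<le> (2 * real N + 1) / of_int ((int k)\<^sup>2) + 2"
    proof (cases "odd k")
      case True
      then have "Rings.coprime 2 (int k)" by simp
      then have "Rings.coprime (2 ^ 8) ((int k)\<^sup>2)"
        by (simp only: coprime_power_left_iff coprime_power_right_iff simp_thms)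
      moreover have "(2 :: int) ^ 8 = 256" by simp
      ultimately have "Rings.coprime 256 ((int k)\<^sup>2)" by (simp only:)
      from card_dvd_linear_le[OF pos this, of N "-27"] show ?thesis using True by (simp add: T_def)
    qed (simp add: T_def)
    ultimately show "real (card (S k)) + real (card (T k)) \<le> 2 * (2 * real N + 1) * (1 / (real k)\<^sup>2) + 4"
      by (simp add: add_divide_distrib)
  qed
  also have "\<dots> = 2 * (2 * real N + 1) * (\<Sum>k\<in>{z<..K}. 1 / (real k)\<^sup>2) + 4 * real (K - z)"
    by (simp add: sum.distrib sum_distrib_left)
  also have "\<dots> \<le> 2 * (2 * real N + 1) * (1 / real z) + 4 * sqrt (283 * real N)"
  proof (intro add_mono mult_left_mono)
    show "(\<Sum>k\<in>{z<..K}. 1 / (real k)\<^sup>2) \<le> 1 / real z"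
    proof (cases "z \<le> K")
      case True
      have "0 \<le> 1 / real K" by simp
      with sum_inverse_squares_tail[of z K] True z show ?thesis by linarith
    qed simp
    have "real (K - z) \<le> real K" by simp
    then show "real (K - z) \<le> sqrt (283 * real N)" using K' by linarith
  qed auto
  finally have "real (card (?I ?A - ?I ?B)) \<le> 1 + (2 * (2 * real N + 1) * (1 / real z) + 4 * sqrt (283 * real N))"
    by simp
  moreover have "card (?I ?A - ?I ?B) = card (?I ?A) - card (?I ?B)"
    using sieved_superset[of z] by (intro card_Diff_subset finite_abs_le) auto
  ultimately show ?thesis unfolding count_upto_def by simp linarith
qed

text \<open>For each \<epsilon>, \<open>f\<close> eventually stays within \<epsilon> of a single
  \<delta> z. So \<open>f\<close> is Cauchy, and its limit is at least c - \<epsilon>.\<close>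

lemma convergent_from_approximations:
  fixes f :: "nat \<Rightarrow> real" and F :: "nat \<Rightarrow> nat \<Rightarrow> real"
  assumes lim: "\<And>z. z \<ge> 2 \<Longrightarrow> F z \<longlonglongrightarrow> \<delta> z" and lower: "\<And>z. z \<ge> 2 \<Longrightarrow> c \<le> \<delta> z"
    and approx: "\<And>z N. z \<ge> 2 \<Longrightarrow> N \<ge> 1 \<Longrightarrow> \<bar>f N - F z N\<bar> \<le> 2 / real z + e N" and e: "e \<longlonglongrightarrow> 0"
  shows "\<exists>l. f \<longlonglongrightarrow> l \<and> c \<le> l"
proof -
  have near: "\<exists>z\<ge>2. \<exists>M. \<forall>N\<ge>M. \<bar>f N - \<delta> z\<bar> < \<epsilon>" if \<epsilon>: "\<epsilon> > 0" for \<epsilon>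
  proof -
    \<comment> \<open>Three errors of \<epsilon> / 3 each: from 2 / z, from the convergence of
      \<open>F z\<close>, and from \<open>e\<close>.\<close>
    obtain z0 :: nat where z0: "6 / \<epsilon> < real z0" using reals_Archimedean2 by blast
    define z where "z = max 2 z0"
    have z: "z \<ge> 2" "6 / \<epsilon> < real z" using z0 by (auto simp: z_def)
    then have 1: "2 / real z < \<epsilon> / 3" using \<epsilon> by (simp add: field_simps)
    obtain M1 where M1: "\<And>N. N \<ge> M1 \<Longrightarrow> \<bar>F z N - \<delta> z\<bar> < \<epsilon> / 3"
      using LIMSEQ_D[OF lim[OF z(1)], of "\<epsilon> / 3"] \<epsilon> by auto
    obtain M2 where M2: "\<And>N. N \<ge> M2 \<Longrightarrow> \<bar>e N\<bar> < \<epsilon> / 3"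
      using LIMSEQ_D[OF e, of "\<epsilon> / 3"] \<epsilon> by auto
    have "\<bar>f N - \<delta> z\<bar> < \<epsilon>" if N: "N \<ge> max 1 (max M1 M2)" for N
      using approx[OF z(1), of N] M1[of N] M2[of N] 1 N by linarith
    then show ?thesis using z(1) by blast
  qed
  have "Cauchy f"
  proof (rule CauchyI)
    fix \<epsilon> :: real assume "\<epsilon> > 0"
    then obtain z M where M: "\<And>N. N \<ge> M \<Longrightarrow> \<bar>f N - \<delta> z\<bar> < \<epsilon> / 2" using near[of "\<epsilon> / 2"] by auto
    have "norm (f m - f n) < \<epsilon>" if "m \<ge> M" "n \<ge> M" for m n
      using M[OF that(1)] M[OF that(2)] unfolding real_norm_def by linarith
    then show "\<exists>M. \<forall>m\<ge>M. \<forall>n\<ge>M. norm (f m - f n) < \<epsilon>" by blast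
  qed
  then obtain l where l: "f \<longlonglongrightarrow> l" using Cauchy_convergent convergent_def by blast
  have "c - \<epsilon> \<le> l" if \<epsilon>: "\<epsilon> > 0" for \<epsilon>
  proof -
    obtain z M where z: "z \<ge> 2" and M: "\<And>N. N \<ge> M \<Longrightarrow> \<bar>f N - \<delta> z\<bar> < \<epsilon>" using near[OF \<epsilon>] by auto
    have "c - \<epsilon> \<le> f N" if "N \<ge> M" for N using M[OF that] lower[OF z] by linarith
    then show ?thesis using LIMSEQ_le_const[OF l] by blast
  qed
  then have "c \<le> l" by (metis add.commute diff_le_eq field_le_epsilon)
  with l show ?thesis by blast
qed

lemma natural_density_monogeneity_hyps:
  "\<exists>\<delta>. has_natural_density {d. monogeneity_hyps 1 d} \<delta> \<and> (14 - pi\<^sup>2) / pi\<^sup>2 \<le> \<delta>"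
proof -
  let ?B = "{d. monogeneity_hyps 1 d}"
  define \<delta> where "\<delta> z = (SOME \<delta>. has_natural_density (sieved z) \<delta>)" for z
  have \<delta>: "has_natural_density (sieved z) (\<delta> z)" for z
    unfolding \<delta>_def using sieved_density_exists by (rule someI_ex)
  let ?f = "\<lambda>A N. real (count_upto A N) / (2 * real N + 1)"
  have "\<exists>l. ?f ?B \<longlonglongrightarrow> l \<and> (14 - pi\<^sup>2) / pi\<^sup>2 \<le> l"
  proof (rule convergent_from_approximations)
    show "?f (sieved z) \<longlonglongrightarrow> \<delta> z" for z using \<delta> unfolding has_natural_density_iff .
    show "(14 - pi\<^sup>2) / pi\<^sup>2 \<le> \<delta> z" if "z \<ge> 2" for z by (rule sieved_density_ge[OF that \<delta>])
    show "(\<lambda>N. (4 * sqrt (283 * real N) + 1) / (2 * real N + 1)) \<longlonglongrightarrow> 0" by real_asymp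
    fix z N :: nat assume z: "z \<ge> 2" and N: "N \<ge> 1"
    have "count_upto ?B N \<le> count_upto (sieved z) N"
      unfolding count_upto_def using sieved_superset[of z] by (intro card_mono finite_abs_le) auto
    then have "\<bar>?f ?B N - ?f (sieved z) N\<bar> = (real (count_upto (sieved z) N) - real (count_upto ?B N)) / (2 * real N + 1)"
      by (simp add: diff_divide_distrib[symmetric] abs_divide)
    also have "\<dots> \<le> (2 * (2 * real N + 1) / real z + 4 * sqrt (283 * real N) + 1) / (2 * real N + 1)"
      by (intro divide_right_mono count_sieved_diff_le z N) simp
    also have "\<dots> = 2 / real z + (4 * sqrt (283 * real N) + 1) / (2 * real N + 1)"
      using z by (simp add: field_simps)
    finally show "\<bar>?f ?B N - ?f (sieved z) N\<bar> \<le> 2 / real z + (4 * sqrt (283 * real N) + 1) / (2 * real N + 1)" .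
  qed
  then show ?thesis unfolding has_natural_density_iff .
qed

theorem theorem3p4:
  shows "(\<forall>(d::int) (\<tau>::complex).
            poly (map_poly of_int (g_poly 1 d)) \<tau> = 0 \<and> monogeneity_hyps 1 d \<and> d \<noteq> -2 \<longrightarrow>
            has_galois_group (rat_adjoin \<tau>) (sym_group 4)) \<and>
         (\<exists>\<delta>::real. has_natural_density {d. monogeneity_hyps 1 d} \<delta> \<and>
            \<delta> \<ge> (14 - pi ^ 2) / pi ^ 2)"
proof (intro conjI allI impI)
  fix d :: int and \<tau> :: complex
  assume *: "poly (map_poly of_int (g_poly 1 d)) \<tau> = 0 \<and> monogeneity_hyps 1 d \<and> d \<noteq> -2"
  then have "d \<noteq> 0" by (auto simp: monogeneity_hyps_def)
  with * show "has_galois_group (rat_adjoin \<tau>) (sym_group 4)"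
    by (intro quartic_has_galois_group_sym_group) (auto simp: monogeneity_hyps_def)
qed (rule natural_density_monogeneity_hyps)

end
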